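(* 1. The Lie algebra $\mathfrak{u}_\infty$ is a uniserial, neither Artinian nor Noetherian, almost Artinian Lie algebra, and its uniserial dimension is $\mathrm{u.dim}(\mathfrak{u}_\infty)=\omega^\omega$. 2. All the ideals of the Lie algebra $\mathfrak{u}_\infty$ are characteristic ideals, i.e. $\sigma(I)=I$ for every ideal $I$ and every $K$-automorphism $\sigma$ of the Lie algebra $\mathfrak{u}_\infty$.
   Context: $K$ is a field of characteristic zero, $P_0=K$, $P_i=K[x_1,\ldots,x_i]$, $\partial_i=\partial/\partial x_i$. $\mathfrak{u}_\infty=\bigcup_{n\ge 2}\mathfrak{u}_n=\bigoplus_{i\ge 1}P_{i-1}\partial_i$ is the union of the Lie algebras $\mathfrak{u}_n=K\partial_1+P_1\partial_2+\cdots+P_{n-1}\partial_n\subseteq\mathrm{Der}_K(P_n)$, $n\ge 2$. A Lie algebra $\mathcal{G}$ is Artinian (Noetherian) if every descending (ascending) chain of ideals stabilizes; it is uniserial if for any two ideals $\mathfrak{a},\mathfrak{b}$ either $\mathfrak{a}\subseteq\mathfrak{b}$ or $\mathfrak{b}\subseteq\mathfrak{a}$; it is almost Artinian if $\mathcal{G}/I$ is an Artinian Lie algebra for every nonzero ideal $I$ of $\mathcal{G}$. The uniserial dimension $\mathrm{u.dim}(\mathcal{G})$ of an arbitrary Lie algebra is the supremum of the order types of those sets of ideals of $\mathcal{G}$ that are totally ordered by inclusion and in which every nonempty subset has a least element. $\omega$ is the first infinite ordinal and $\omega^\omega$ is ordinal exponentiation. *)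

theory Defs
  imports
    "HOL-Library.Poly_Mapping"
    "HOL-Algebra.Module"
    "HOL-Algebra.QuotRing"
    "HOL-Algebra.Algebraic_Closure_Type"
begin

section \<open>Lie algebras\<close>

text \<open>
  A Lie algebra over \<open>K\<close> is a \<^typ>\<open>('k, 'v) module\<close> record whose \<^const>\<open>mult\<close> field is the
  Lie bracket, \<open>x \<otimes>\<^bsub>L\<^esub> y = [x, y]\<close>. The field \<^const>\<open>one\<close> of the record has no meaning here and
  never matters (the locale \<^locale>\<open>module\<close> only looks at the additive group and \<^const>\<open>module.smult\<close>).
\<close>

locale lie_algebra = field K + module K L for K (structure) and L (structure) +
  assumes bracket_closed:
      "\<lbrakk>x \<in> carrier L; y \<in> carrier L\<rbrakk> \<Longrightarrow> x \<otimes>\<^bsub>L\<^esub> y \<in> carrier L"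
    and bracket_add_left:
      "\<lbrakk>x \<in> carrier L; y \<in> carrier L; z \<in> carrier L\<rbrakk> \<Longrightarrow>
        (x \<oplus>\<^bsub>L\<^esub> y) \<otimes>\<^bsub>L\<^esub> z = (x \<otimes>\<^bsub>L\<^esub> z) \<oplus>\<^bsub>L\<^esub> (y \<otimes>\<^bsub>L\<^esub> z)"
    and bracket_add_right:
      "\<lbrakk>x \<in> carrier L; y \<in> carrier L; z \<in> carrier L\<rbrakk> \<Longrightarrow>
        x \<otimes>\<^bsub>L\<^esub> (y \<oplus>\<^bsub>L\<^esub> z) = (x \<otimes>\<^bsub>L\<^esub> y) \<oplus>\<^bsub>L\<^esub> (x \<otimes>\<^bsub>L\<^esub> z)"
    and bracket_smult_left:
      "\<lbrakk>c \<in> carrier K; x \<in> carrier L; y \<in> carrier L\<rbrakk> \<Longrightarrow>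
        (c \<odot>\<^bsub>L\<^esub> x) \<otimes>\<^bsub>L\<^esub> y = c \<odot>\<^bsub>L\<^esub> (x \<otimes>\<^bsub>L\<^esub> y)"
    and bracket_smult_right:
      "\<lbrakk>c \<in> carrier K; x \<in> carrier L; y \<in> carrier L\<rbrakk> \<Longrightarrow>
        x \<otimes>\<^bsub>L\<^esub> (c \<odot>\<^bsub>L\<^esub> y) = c \<odot>\<^bsub>L\<^esub> (x \<otimes>\<^bsub>L\<^esub> y)"
    and bracket_alternating:
      "x \<in> carrier L \<Longrightarrow> x \<otimes>\<^bsub>L\<^esub> x = \<zero>\<^bsub>L\<^esub>"
    and jacobi:
      "\<lbrakk>x \<in> carrier L; y \<in> carrier L; z \<in> carrier L\<rbrakk> \<Longrightarrow>
        (x \<otimes>\<^bsub>L\<^esub> (y \<otimes>\<^bsub>L\<^esub> z)) \<oplus>\<^bsub>L\<^esub> (y \<otimes>\<^bsub>L\<^esub> (z \<otimes>\<^bsub>L\<^esub> x)) \<oplus>\<^bsub>L\<^esub> (z \<otimes>\<^bsub>L\<^esub> (x \<otimes>\<^bsub>L\<^esub> y)) = \<zero>\<^bsub>L\<^esub>"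

definition lie_ideal :: "'k ring \<Rightarrow> ('k, 'v) module \<Rightarrow> 'v set \<Rightarrow> bool" where
  "lie_ideal K L I \<longleftrightarrow> submodule I K L \<and> (\<forall>x\<in>carrier L. \<forall>y\<in>I. x \<otimes>\<^bsub>L\<^esub> y \<in> I)"

text \<open>\<^const>\<open>FactRing\<close> provides the cosets with their induced addition and bracket.\<close>

definition lie_quotient :: "('k, 'v) module \<Rightarrow> 'v set \<Rightarrow> ('k, 'v set) module" where
  "lie_quotient L I =
    ring.extend (FactRing L I) (module.fields (\<lambda>c A. \<Union>x\<in>A. I +>\<^bsub>L\<^esub> (c \<odot>\<^bsub>L\<^esub> x)))"

definition lie_automorphism :: "'k ring \<Rightarrow> ('k, 'v) module \<Rightarrow> ('v \<Rightarrow> 'v) \<Rightarrow> bool" where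
  "lie_automorphism K L \<sigma> \<longleftrightarrow>
    bij_betw \<sigma> (carrier L) (carrier L) \<and>
    (\<forall>x\<in>carrier L. \<forall>y\<in>carrier L. \<sigma> (x \<oplus>\<^bsub>L\<^esub> y) = \<sigma> x \<oplus>\<^bsub>L\<^esub> \<sigma> y) \<and>
    (\<forall>c\<in>carrier K. \<forall>x\<in>carrier L. \<sigma> (c \<odot>\<^bsub>L\<^esub> x) = c \<odot>\<^bsub>L\<^esub> \<sigma> x) \<and>
    (\<forall>x\<in>carrier L. \<forall>y\<in>carrier L. \<sigma> (x \<otimes>\<^bsub>L\<^esub> y) = \<sigma> x \<otimes>\<^bsub>L\<^esub> \<sigma> y)"

definition characteristic_ideal :: "'k ring \<Rightarrow> ('k, 'v) module \<Rightarrow> 'v set \<Rightarrow> bool" where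
  "characteristic_ideal K L I \<longleftrightarrow>
    lie_ideal K L I \<and> (\<forall>\<sigma>. lie_automorphism K L \<sigma> \<longrightarrow> \<sigma> ` I = I)"

definition uniserial :: "'k ring \<Rightarrow> ('k, 'v) module \<Rightarrow> bool" where
  "uniserial K L \<longleftrightarrow> (\<forall>I J. lie_ideal K L I \<longrightarrow> lie_ideal K L J \<longrightarrow> I \<subseteq> J \<or> J \<subseteq> I)"

definition lie_artinian :: "'k ring \<Rightarrow> ('k, 'v) module \<Rightarrow> bool" where
  "lie_artinian K L \<longleftrightarrow>
    (\<forall>I :: nat \<Rightarrow> 'v set. (\<forall>n. lie_ideal K L (I n)) \<and> (\<forall>n. I (Suc n) \<subseteq> I n) \<longrightarrow>
      (\<exists>N. \<forall>n\<ge>N. I n = I N))"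

definition lie_noetherian :: "'k ring \<Rightarrow> ('k, 'v) module \<Rightarrow> bool" where
  "lie_noetherian K L \<longleftrightarrow>
    (\<forall>I :: nat \<Rightarrow> 'v set. (\<forall>n. lie_ideal K L (I n)) \<and> (\<forall>n. I n \<subseteq> I (Suc n)) \<longrightarrow>
      (\<exists>N. \<forall>n\<ge>N. I n = I N))"

definition almost_artinian :: "'k ring \<Rightarrow> ('k, 'v) module \<Rightarrow> bool" where
  "almost_artinian K L \<longleftrightarrow>
    (\<forall>I. lie_ideal K L I \<longrightarrow> I \<noteq> {\<zero>\<^bsub>L\<^esub>} \<longrightarrow> lie_artinian K (lie_quotient L I))"


section \<open>Uniserial dimension\<close>

definition well_ordered_ideals :: "'k ring \<Rightarrow> ('k, 'v) module \<Rightarrow> 'v set set \<Rightarrow> bool" where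
  "well_ordered_ideals K L S \<longleftrightarrow>
    (\<forall>I\<in>S. lie_ideal K L I) \<and>
    (\<forall>I\<in>S. \<forall>J\<in>S. I \<subseteq> J \<or> J \<subseteq> I) \<and>
    (\<forall>T\<subseteq>S. T \<noteq> {} \<longrightarrow> (\<exists>I\<in>T. \<forall>J\<in>T. I \<subseteq> J))"

definition incl_order :: "'a set set \<Rightarrow> 'a set rel" where
  "incl_order S = {(I, J). I \<in> S \<and> J \<in> S \<and> I \<subseteq> J}"

text \<open>
  Ordinals are represented by well-orders up to isomorphism. The following says that the
  ordinal of \<open>r\<close> is the supremum of the order types of the well-ordered sets of ideals of \<open>L\<close>.
  It suffices that the competing upper bounds \<open>r'\<close> live on the type of \<open>r\<close>: an ordinal smaller
  than that of \<open>r\<close> is the order type of a proper initial segment of \<open>r\<close>.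
\<close>

definition has_uniserial_dim :: "'k ring \<Rightarrow> ('k, 'v) module \<Rightarrow> 'o rel \<Rightarrow> bool" where
  "has_uniserial_dim K L r \<longleftrightarrow>
    Well_order r \<and>
    (\<forall>S. well_ordered_ideals K L S \<longrightarrow> (incl_order S, r) \<in> ordLeq) \<and>
    (\<forall>r' :: 'o rel. Well_order r' \<longrightarrow>
      (\<forall>S. well_ordered_ideals K L S \<longrightarrow> (incl_order S, r') \<in> ordLeq) \<longrightarrow> (r, r') \<in> ordLeq)"

text \<open>
  Ordinal exponentiation \<open>r\<close> to the power \<open>s\<close>: the functions from \<open>s\<close> to \<open>r\<close> of finite support
  (with respect to the least element of \<open>r\<close>), compared at the largest argument where they differ.
\<close>

definition fin_supp_funs :: "'a rel \<Rightarrow> 'b rel \<Rightarrow> ('b \<Rightarrow> 'a) set" where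
  "fin_supp_funs r s =
    {f \<in> Func (Field s) (Field r). finite {x \<in> Field s. f x \<noteq> wo_rel.minim r (Field r)}}"

definition ord_exp :: "'a rel \<Rightarrow> 'b rel \<Rightarrow> ('b \<Rightarrow> 'a) rel" where
  "ord_exp r s =
    {(f, g). f \<in> fin_supp_funs r s \<and> g \<in> fin_supp_funs r s \<and>
      (f = g \<or>
       (\<exists>x\<in>Field s. f x \<noteq> g x \<and> (f x, g x) \<in> r \<and>
          (\<forall>y. (x, y) \<in> s \<and> y \<noteq> x \<longrightarrow> f y = g y)))}"

abbreviation omega :: "nat rel" where
  "omega \<equiv> natLeq"


section \<open>The Lie algebra of triangular derivations\<close>

text \<open>
  Polynomials over \<open>'k\<close> in variables indexed by \<^typ>\<open>nat\<close>, as finitely supported functions on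
  exponent vectors. Indices start at \<open>0\<close>: the variable number \<open>i\<close> is the usual \<open>x\<^sub>i\<^sub>+\<^sub>1\<close>.
\<close>

type_synonym 'k mpol = "(nat \<Rightarrow>\<^sub>0 nat) \<Rightarrow>\<^sub>0 'k"

definition const_pol :: "'k::comm_ring_1 \<Rightarrow> 'k mpol" where
  "const_pol c = Poly_Mapping.single 0 c"

text \<open>\<open>pol_upto n\<close> is \<open>P\<^sub>n\<close>, the polynomials in the first \<open>n\<close> variables.\<close>

definition pol_upto :: "nat \<Rightarrow> 'k::comm_ring_1 mpol set" where
  "pol_upto n = {p. \<forall>m\<in>Poly_Mapping.keys p. Poly_Mapping.keys m \<subseteq> {..<n}}"

text \<open>
  Where the exponent of variable \<open>i\<close> in \<open>m\<close> is \<open>0\<close>, the (truncated) subtraction of exponents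
  is harmless because the coefficient vanishes.
\<close>

definition pderiv_var :: "nat \<Rightarrow> 'k::comm_ring_1 mpol \<Rightarrow> 'k mpol" where
  "pderiv_var i p =
    (\<Sum>m\<in>Poly_Mapping.keys p.
      Poly_Mapping.single (m - Poly_Mapping.single i 1)
        (of_nat (Poly_Mapping.lookup m i) * Poly_Mapping.lookup p m))"

text \<open>
  An element \<open>\<Sum>i<n. a\<^sub>i \<partial>\<^sub>i\<close> of \<open>\<uu>\<^sub>n\<close> is taken as a derivation of the polynomial ring in all
  variables (it kills the variables of index \<open>\<ge> n\<close>); this is the identification under which
  \<open>\<uu>\<^sub>n \<subseteq> \<uu>\<^sub>n\<^sub>+\<^sub>1\<close>. With indices starting at \<open>0\<close> the coefficient of \<open>\<partial>\<^sub>i\<close> lies in \<open>P\<^sub>i\<close>.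
\<close>

definition u_fin :: "nat \<Rightarrow> ('k::comm_ring_1 mpol \<Rightarrow> 'k mpol) set" where
  "u_fin n = {D. \<exists>a. (\<forall>i<n. a i \<in> pol_upto i) \<and> D = (\<lambda>f. \<Sum>i<n. a i * pderiv_var i f)}"

definition u_infinity :: "('k::field_char_0, 'k mpol \<Rightarrow> 'k mpol) module" where
  "u_infinity =
    \<lparr>carrier = (\<Union>n\<in>{2..}. u_fin n),
     monoid.mult = (\<lambda>D E f. D (E f) - E (D f)),
     one = undefined,
     ring.zero = (\<lambda>f. 0),
     add = (\<lambda>D E f. D f + E f),
     module.smult = (\<lambda>c D f. const_pol c * D f)\<rparr>"

end

theory Submission
  imports Defs
begin

text \<open>
  Indices start at \<open>0\<close>, so that the coefficient of \<open>\<partial>\<^sub>i\<close> lies in \<open>P\<^sub>i\<close>, the polynomials in the first \<open>i\<close>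
  variables. A nonzero element of \<open>\<uu>\<^sub>\<infinity>\<close> has a leading term \<open>x\<^sup>a \<partial>\<^sub>i\<close>: the index \<open>i\<close> is the smallest one with a
  nonzero coefficient, and \<open>a\<close> is the largest exponent vector in this coefficient when vectors are
  compared at the highest variable where they differ. Leading terms are ordered by letting a smaller
  \<open>i\<close> be larger and comparing exponent vectors for equal \<open>i\<close>. The theorem rests on the fact that an
  ideal contains with an element every element whose leading term is not larger
  (\<open>ideal_downward_closed\<close>); conversely, the elements with leading term below a given one form an
  ideal (\<open>tri_ideal_lower\<close>).

  The first fact has two halves. Within the block \<open>P\<^sub>i \<partial>\<^sub>i\<close>, the bracket with \<open>x\<^sup>d \<partial>\<^sub>k\<close> lowers the exponent
  of variable \<open>k\<close> by one and raises those of smaller variables at will, so every smaller exponent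
  vector is reached (\<open>ideal_fills_block\<close>). To pass to later blocks (\<open>ideal_contains_tail\<close>), the leading
  term is first lowered to \<open>\<partial>\<^sub>i\<close>. Bracketing with \<open>x\<^sub>i\<^sup>n\<^sup>+\<^sup>1 \<partial>\<^sub>i\<^sub>+\<^sub>1\<close> gives arbitrarily large leading terms in
  the next block, and bracketing with \<open>x\<^sub>i \<partial>\<^sub>m\<close> for a sufficiently large \<open>m\<close> gives \<open>\<partial>\<^sub>m\<close> itself, whose
  brackets exhaust \<open>P\<^sub>m\<^sub>+\<^sub>1 \<partial>\<^sub>m\<^sub>+\<^sub>1 \<oplus> P\<^sub>m\<^sub>+\<^sub>2 \<partial>\<^sub>m\<^sub>+\<^sub>2 \<oplus> \<dots>\<close>; the finitely many blocks between are then filled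
  one after the other, from the last to the first.

  As leading terms are totally ordered, any two ideals are comparable. The tails
  \<open>P\<^sub>i \<partial>\<^sub>i \<oplus> P\<^sub>i\<^sub>+\<^sub>1 \<partial>\<^sub>i\<^sub>+\<^sub>1 \<oplus> \<dots>\<close> descend strictly, and between two successive tails of
  positive index there are infinite strictly ascending chains. Every nonzero ideal contains a tail, and above a fixed tail only
  finitely many blocks remain, so the ideals there are well-ordered: the least leading term missing
  from an ideal ranks it strictly monotonically in \<open>\<omega>\<^sup>\<omega>\<close> (\<open>ideal_rank_strict_mono\<close>). This shows that
  proper quotients are Artinian and that well-ordered sets of ideals have order type at most \<open>\<omega>\<^sup>\<omega>\<close>.
  The bound is not improvable since the ideals inside block \<open>m\<close> already have order type \<open>\<omega>\<^sup>m\<close>.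

  Finally, each tail is the derived algebra of the preceding one, so an automorphism fixes the
  tails. An ideal \<open>I\<close> and its image are comparable, and if one were strictly contained in the other,
  iterating the automorphism or its inverse would give an infinite strictly descending chain above
  a fixed tail.
\<close>

section \<open>Finitely supported functions and the ordinal \<open>\<omega>\<^sup>\<omega>\<close>\<close>

definition colex :: "(nat \<Rightarrow> nat) \<Rightarrow> (nat \<Rightarrow> nat) \<Rightarrow> bool" where
  "colex f g \<longleftrightarrow> (\<exists>k. f k < g k \<and> (\<forall>l>k. f l = g l))"

definition finsupp :: "(nat \<Rightarrow> nat) set" where
  "finsupp = {f. finite {x. f x \<noteq> 0}}"

lemma colex_irrefl [simp]: "\<not> colex f f"
  by (simp add: colex_def)

lemma colex_trans: "colex f g \<Longrightarrow> colex g h \<Longrightarrow> colex f h"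
  unfolding colex_def
proof (elim exE conjE)
  fix k l
  assume "f k < g k" "\<forall>j>k. f j = g j" "g l < h l" "\<forall>j>l. g j = h j"
  then show "\<exists>k. f k < h k \<and> (\<forall>j>k. f j = h j)"
    by (intro exI[of _ "max k l"]) (cases k l rule: linorder_cases; auto simp: max_def)
qed

lemma colex_asym: "colex f g \<Longrightarrow> \<not> colex g f"
  using colex_trans colex_irrefl by blast

lemma colex_total:
  assumes "f \<in> finsupp" "g \<in> finsupp"
  shows "f = g \<or> colex f g \<or> colex g f"
proof (cases "f = g")
  case False
  let ?A = "{k. f k \<noteq> g k}"
  have "?A \<subseteq> {x. f x \<noteq> 0} \<union> {x. g x \<noteq> 0}" by auto
  then have fin: "finite ?A"
    using assms by (auto simp: finsupp_def intro: finite_subset)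
  have ne: "?A \<noteq> {}" using False by auto
  define k where "k = Max ?A"
  have "f k \<noteq> g k" using Max_in[OF fin ne] by (simp add: k_def)
  moreover have "\<forall>l>k. f l = g l" using Max_ge[OF fin] unfolding k_def
    by (metis (mono_tags, lifting) linorder_not_less mem_Collect_eq)
  ultimately show ?thesis unfolding colex_def by (metis linorder_neqE_nat)
qed auto

lemma colex_if_le:
  assumes "f \<in> finsupp" "g \<in> finsupp" "\<And>k. f k \<le> g k"
  shows "f = g \<or> colex f g"
  using colex_total[OF assms(1,2)] assms(3) unfolding colex_def by (meson linorder_not_less)

text \<open>
  The position of the deciding argument is unbounded in general, but below a function supported on \<open>{..<m}\<close> only functions supported on \<open>{..<m}\<close> occur, and
  for these the value at the top argument can be minimised first.
\<close>

lemma colex_minimal_bounded: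
  assumes "g \<in> A" "\<forall>x\<ge>m. g x = 0"
  shows "\<exists>f\<in>A. \<forall>g\<in>A. \<not> colex g f"
  using assms
proof (induction m arbitrary: A g)
  case 0
  then have "\<not> colex h g" for h by (simp add: colex_def)
  with 0(1) show ?case by blast
next
  case (Suc m)
  let ?B = "{h\<in>A. \<forall>x\<ge>Suc m. h x = 0}"
  define v where "v = (LEAST v. \<exists>h\<in>?B. h m = v)"
  have "\<exists>h\<in>?B. h m = v" unfolding v_def
    by (rule LeastI_ex) (use Suc.prems in blast)
  then obtain h where h: "h \<in> ?B" "h m = v" by blast
  have v_le: "v \<le> h m" if "h \<in> ?B" for h
    unfolding v_def by (rule Least_le) (use that in blast)
  let ?C = "(\<lambda>h. h(m := 0)) ` {h\<in>?B. h m = v}"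
  have "h(m := 0) \<in> ?C" using h by blast
  moreover have "\<forall>x\<ge>m. (h(m := 0)) x = 0" using h(1) by (simp add: Suc_le_eq)
  ultimately obtain f' where f': "f' \<in> ?C" "\<forall>g\<in>?C. \<not> colex g f'"
    using Suc.IH[of "h(m := 0)" ?C] by blast
  then obtain f where f: "f \<in> ?B" "f m = v" "f' = f(m := 0)" by blast
  have "\<not> colex g f" if g: "g \<in> A" for g
  proof
    assume "colex g f"
    then obtain k where k: "g k < f k" "\<forall>l>k. g l = f l" by (auto simp: colex_def)
    have "k \<le> m" using k(1) f(1) by (metis (mono_tags, lifting) mem_Collect_eq less_zeroE not_less_eq_eq)
    then have "g l = 0" if "l \<ge> Suc m" for l
      using k(2) f(1) that by (simp add: Suc_le_eq)
    then have gB: "g \<in> ?B" using g by blast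
    show False
    proof (cases "k = m")
      case True
      then show False using v_le[OF gB] k(1) f(2) by simp
    next
      case False
      then have "k < m" using \<open>k \<le> m\<close> by simp
      then have "g m = v" using k(2) f(2) by simp
      then have "g(m := 0) \<in> ?C" using gB by blast
      moreover have "colex (g(m := 0)) f'"
        unfolding colex_def f(3) using k \<open>k < m\<close> by (intro exI[of _ k]) simp
      ultimately show False using f'(2) by blast
    qed
  qed
  then show ?case using f(1) by blast
qed

lemma finsupp_bound: "f \<in> finsupp \<Longrightarrow> \<exists>m. \<forall>x\<ge>m. f x = 0"
  unfolding finsupp_def
  by (metis (mono_tags, lifting) finite_nat_bounded lessThan_iff mem_Collect_eq not_le subsetD)

lemma colex_least:
  assumes "A \<subseteq> finsupp" "A \<noteq> {}"
  shows "\<exists>f\<in>A. \<forall>g\<in>A. f = g \<or> colex f g"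
proof -
  obtain g where "g \<in> A" using assms by auto
  moreover obtain m where "\<forall>x\<ge>m. g x = 0" using finsupp_bound assms(1) \<open>g \<in> A\<close> by blast
  ultimately obtain f where f: "f \<in> A" "\<forall>g\<in>A. \<not> colex g f"
    using colex_minimal_bounded by blast
  have "f = g \<or> colex f g" if "g \<in> A" for g
  proof -
    have "f \<in> finsupp" "g \<in> finsupp" using f(1) that assms(1) by auto
    then show ?thesis using colex_total f(2) that by blast
  qed
  then show ?thesis using f(1) by blast
qed

lemma ord_exp_omega_omega:
  "ord_exp omega omega = {(f, g). f \<in> finsupp \<and> g \<in> finsupp \<and> (f = g \<or> colex f g)}"
proof -
  \<comment> \<open>the order is kept folded, as \<open>Field_natLeq\<close> needs it\<close>
  have le: "(x, y) \<in> omega \<longleftrightarrow> x \<le> y" for x y by (simp add: natLeq_def)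
  have "wo_rel.minim omega (Field omega) = 0"
  proof (rule wo_rel.equals_minim[symmetric])
    show "wo_rel omega" using natLeq_Well_order by (simp add: wo_rel_def)
  qed (auto simp: Field_natLeq le)
  then have "fin_supp_funs omega omega = finsupp"
    by (auto simp: fin_supp_funs_def finsupp_def Field_natLeq Func_def)
  then show ?thesis
    unfolding ord_exp_def colex_def Field_natLeq le
    by (simp add: nat_less_le conj_ac eq_commute)
qed

lemma Field_ord_exp_omega_omega: "Field (ord_exp omega omega) = finsupp"
  unfolding ord_exp_omega_omega Field_def by auto

lemma Well_order_if_least:
  assumes "Refl r" "antisym r"
    and least: "\<And>A. A \<subseteq> Field r \<Longrightarrow> A \<noteq> {} \<Longrightarrow> \<exists>a\<in>A. \<forall>b\<in>A. (a, b) \<in> r"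
    and "trans r"
  shows "Well_order r"
proof -
  have tot: "(a, b) \<in> r \<or> (b, a) \<in> r" if "a \<in> Field r" "b \<in> Field r" for a b
    using least[of "{a, b}"] that by auto
  have lin: "Linear_order r"
    unfolding linear_order_on_def partial_order_on_def preorder_on_def total_on_def
    using assms tot by (auto simp: refl_on_def FieldI1 FieldI2)
  have "\<forall>A\<subseteq>Field r. A \<noteq> {} \<longrightarrow> (\<exists>a\<in>A. \<forall>b\<in>A. (a, b) \<in> r)"
    using least by blast
  then show ?thesis using lin by (simp add: Linear_order_Well_order_iff)
qed

lemma Well_order_ord_exp_omega_omega: "Well_order (ord_exp omega omega)"
proof (rule Well_order_if_least)
  show "Refl (ord_exp omega omega)"
    unfolding refl_on_def Field_ord_exp_omega_omega by (auto simp: ord_exp_omega_omega)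
  show "antisym (ord_exp omega omega)"
    unfolding ord_exp_omega_omega using colex_asym by (intro antisymI) blast
  show "trans (ord_exp omega omega)"
    unfolding ord_exp_omega_omega using colex_trans by (intro transI) blast
next
  fix A assume A: "A \<subseteq> Field (ord_exp omega omega)" "A \<noteq> {}"
  then have sub: "A \<subseteq> finsupp" by (simp add: Field_ord_exp_omega_omega)
  then obtain f where f: "f \<in> A" "\<And>g. g \<in> A \<Longrightarrow> f = g \<or> colex f g"
    using colex_least A(2) by meson
  then have "(f, g) \<in> ord_exp omega omega" if "g \<in> A" for g
    using that sub by (auto simp: ord_exp_omega_omega)
  then show "\<exists>a\<in>A. \<forall>b\<in>A. (a, b) \<in> ord_exp omega omega" using f(1) by blast
qed

lemma Well_order_facts:
  assumes "Well_order r"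
  shows "\<And>a. a \<in> Field r \<Longrightarrow> (a, a) \<in> r"
    and "\<And>a b. a \<in> Field r \<Longrightarrow> b \<in> Field r \<Longrightarrow> (a, b) \<notin> r \<Longrightarrow> (b, a) \<in> r \<and> a \<noteq> b"
    and "\<And>a b. (a, b) \<in> r \<Longrightarrow> (b, a) \<in> r \<Longrightarrow> a = b"
    and "\<And>A. A \<subseteq> Field r \<Longrightarrow> A \<noteq> {} \<Longrightarrow> \<exists>a\<in>A. \<forall>b\<in>A. (a, b) \<in> r"
proof -
  have wo: "wo_rel r" using assms by (simp add: wo_rel_def)
  have lin: "Linear_order r" using assms by (simp add: well_order_on_def)
  show 1: "(a, a) \<in> r" if "a \<in> Field r" for a
    using wo_rel.REFL[OF wo] that by (simp add: refl_on_def)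
  show "(b, a) \<in> r \<and> a \<noteq> b" if "a \<in> Field r" "b \<in> Field r" "(a, b) \<notin> r" for a b
    using wo_rel.TOTALS[OF wo] that 1 by metis
  show "a = b" if "(a, b) \<in> r" "(b, a) \<in> r" for a b
    using wo_rel.ANTISYM[OF wo] that by (meson antisymD)
  show "\<exists>a\<in>A. \<forall>b\<in>A. (a, b) \<in> r" if "A \<subseteq> Field r" "A \<noteq> {}" for A
    using Linear_order_Well_order_iff[OF lin] assms that by meson
qed

text \<open>
  The set \<open>D\<close> need not be an initial segment: a least counterexample \<open>a\<close> is mapped below itself, and
  then \<open>h a \<in> D\<close> is a smaller counterexample.
\<close>

lemma strict_mono_inflationary:
  assumes wo: "Well_order r" and D: "D \<subseteq> Field r" and h: "\<And>x. x \<in> D \<Longrightarrow> h x \<in> D"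
    and mono: "\<And>x y. x \<in> D \<Longrightarrow> y \<in> D \<Longrightarrow> (x, y) \<in> r \<Longrightarrow> x \<noteq> y \<Longrightarrow> (h x, h y) \<in> r \<and> h x \<noteq> h y"
    and x: "x \<in> D"
  shows "(x, h x) \<in> r"
proof (rule ccontr)
  assume neg: "(x, h x) \<notin> r"
  let ?A = "{y \<in> D. (y, h y) \<notin> r}"
  have "?A \<subseteq> Field r" "?A \<noteq> {}" using D x neg by auto
  then obtain a where a: "a \<in> D" "(a, h a) \<notin> r" and least: "\<And>b. b \<in> ?A \<Longrightarrow> (a, b) \<in> r"
    using Well_order_facts(4)[OF wo, of ?A] by blast
  have ha: "h a \<in> D" using a h by blast
  have 1: "(h a, a) \<in> r \<and> a \<noteq> h a"
    using Well_order_facts(2)[OF wo _ _ a(2)] a(1) ha D by blast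
  then have "(h (h a), h a) \<in> r \<and> h (h a) \<noteq> h a" using mono[of "h a" a] a(1) ha by auto
  then have "(h a, h (h a)) \<notin> r" using Well_order_facts(3)[OF wo] by metis
  then have "(a, h a) \<in> r" using least ha by blast
  then show False using a(2) by blast
qed

text \<open>
  Embeddings of well-orders are maps onto initial segments, which are awkward to construct or to
  compose with other maps. The next three lemmas trade them for strictly monotone maps: these are
  what the comparison of chains of ideals with exponent vectors produces.
\<close>

lemma ordLess_bounded_embedding:
  assumes "(r, s) \<in> ordLess"
  shows "\<exists>e b. b \<in> Field s \<and> (\<forall>x\<in>Field r. e x \<in> Field s \<and> (e x, b) \<in> s \<and> e x \<noteq> b) \<and>
    (\<forall>x y. (x, y) \<in> r \<longrightarrow> x \<noteq> y \<longrightarrow> (e x, e y) \<in> s \<and> e x \<noteq> e y)"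
proof -
  have wo: "Well_order r" "Well_order s" using assms by (auto simp: ordLess_def)
  obtain e where e: "embedS r s e" using assms by (auto simp: ordLess_def)
  then have emb: "embed r s e" by (simp add: embedS_def)
  have sub: "e ` Field r \<subset> Field s" using e embedS_iff[OF wo(1) emb] by simp
  then obtain b where b: "b \<in> Field s" "b \<notin> e ` Field r" by auto
  have of: "wo_rel.ofilter s (e ` Field r)" using embed_Field_ofilter[OF wo emb] .
  have "e x \<in> Field s \<and> (e x, b) \<in> s \<and> e x \<noteq> b" if "x \<in> Field r" for x
  proof -
    have ex: "e x \<in> Field s" "e x \<noteq> b" using sub that b by auto
    have "under s (e x) \<subseteq> e ` Field r"
      using of that wo_rel.ofilter_def[of s] wo(2) by (simp add: wo_rel_def)
    then have "(b, e x) \<notin> s" using b(2) by (auto simp: under_def)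
    then show ?thesis using ex b(1) Well_order_facts(2)[OF wo(2), of b "e x"] by blast
  qed
  moreover have "(e x, e y) \<in> s \<and> e x \<noteq> e y" if "(x, y) \<in> r" "x \<noteq> y" for x y
    using embed_compat[OF emb] embed_inj_on[OF wo(1) emb] that
    unfolding compat_def inj_on_def by (metis FieldI1 FieldI2)
  ultimately show ?thesis using b(1) by (intro exI[of _ e] exI[of _ b]) simp
qed

lemma ordLeq_strict_mono_embedding:
  assumes "(r, s) \<in> ordLeq"
  shows "\<exists>e. (\<forall>x\<in>Field r. e x \<in> Field s) \<and>
    (\<forall>x y. (x, y) \<in> r \<longrightarrow> x \<noteq> y \<longrightarrow> (e x, e y) \<in> s \<and> e x \<noteq> e y)"
proof -
  have wo: "Well_order r" "Well_order s" using assms by (auto simp: ordLeq_def)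
  obtain e where emb: "embed r s e" using assms by (auto simp: ordLeq_def)
  have "e x \<in> Field s" if "x \<in> Field r" for x using embed_Field[OF emb] that by auto
  moreover have "(e x, e y) \<in> s \<and> e x \<noteq> e y" if "(x, y) \<in> r" "x \<noteq> y" for x y
    using embed_compat[OF emb] embed_inj_on[OF wo(1) emb] that
    unfolding compat_def inj_on_def by (metis FieldI1 FieldI2)
  ultimately show ?thesis by (intro exI[of _ e]) simp
qed

text \<open>
  If \<open>s\<close> were shorter than \<open>r\<close>, it would embed below some \<open>b\<close>; composing with \<open>f\<close> gives a strictly
  monotone map of \<open>r\<close> into itself sending \<open>b\<close> below \<open>b\<close>, which
  \<open>strict_mono_inflationary\<close> forbids.
\<close>

lemma ordLeq_if_strict_mono:
  assumes wo: "Well_order r" "Well_order s"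
    and f: "\<And>x. x \<in> Field r \<Longrightarrow> f x \<in> Field s"
    and mono: "\<And>x y. (x, y) \<in> r \<Longrightarrow> x \<noteq> y \<Longrightarrow> (f x, f y) \<in> s \<and> f x \<noteq> f y"
  shows "(r, s) \<in> ordLeq"
proof (rule ccontr)
  assume "(r, s) \<notin> ordLeq"
  then have "(s, r) \<in> ordLess" using wo not_ordLeq_iff_ordLess by blast
  then obtain e b where b: "b \<in> Field r"
    and e: "\<forall>x\<in>Field s. e x \<in> Field r \<and> (e x, b) \<in> r \<and> e x \<noteq> b"
    and em: "\<forall>x y. (x, y) \<in> s \<longrightarrow> x \<noteq> y \<longrightarrow> (e x, e y) \<in> r \<and> e x \<noteq> e y"
    by (elim ordLess_bounded_embedding[elim_format] exE conjE)
  have "(b, e (f b)) \<in> r"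
    by (rule strict_mono_inflationary[OF wo(1) order_refl, of "e \<circ> f", unfolded o_def])
       (use b e f em mono in auto)
  moreover have "(e (f b), b) \<in> r" "e (f b) \<noteq> b" using e f b by auto
  ultimately show False using Well_order_facts(3)[OF wo(1)] by metis
qed

lemma Field_incl_order: "Field (incl_order S) = S"
  by (auto simp: incl_order_def Field_def)

lemma Well_order_incl_order:
  assumes "well_ordered_ideals K L S"
  shows "Well_order (incl_order S)"
proof (rule Well_order_if_least)
  show "Refl (incl_order S)" unfolding refl_on_def Field_incl_order by (auto simp: incl_order_def)
  show "antisym (incl_order S)" by (auto simp: antisym_def incl_order_def)
  show "trans (incl_order S)" by (auto simp: trans_def incl_order_def)
next
  fix A assume "A \<subseteq> Field (incl_order S)" "A \<noteq> {}"
  then have A: "A \<subseteq> S" "A \<noteq> {}" by (simp_all add: Field_incl_order)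
  then obtain I where "I \<in> A" "\<forall>J\<in>A. I \<subseteq> J"
    using assms unfolding well_ordered_ideals_def by meson
  then show "\<exists>a\<in>A. \<forall>b\<in>A. (a, b) \<in> incl_order S"
    using A(1) by (auto simp: incl_order_def)
qed

section \<open>Polynomials and partial derivatives\<close>

abbreviation unit_mon :: "nat \<Rightarrow> (nat \<Rightarrow>\<^sub>0 nat)" where
  "unit_mon i \<equiv> Poly_Mapping.single i (Suc 0)"

abbreviation var :: "nat \<Rightarrow> 'k::comm_ring_1 mpol" where
  "var i \<equiv> Poly_Mapping.single (unit_mon i) 1"

abbreviation lk where "lk \<equiv> Poly_Mapping.lookup"

lemma unit_mon_minus_plus:
  "lk m i \<noteq> 0 \<Longrightarrow> m - unit_mon i + unit_mon i = m"
  by (rule poly_mapping_eqI) (auto simp: lookup_add lookup_minus lookup_single when_def)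

text \<open>
  The coefficientwise form of the derivative: at most one monomial of \<open>p\<close> contributes to a given
  coefficient. Additivity, the commutation of partial derivatives and their effect on supports are
  read off from it.
\<close>

lemma lookup_pderiv_var:
  fixes p :: "'k::comm_ring_1 mpol"
  shows "lk (pderiv_var i p) b = of_nat (Suc (lk b i)) * lk p (b + unit_mon i)"
proof -
  let ?t = "\<lambda>m. lk (Poly_Mapping.single (m - unit_mon i) (of_nat (lk m i) * lk p m)) b"
  let ?m = "b + unit_mon i"
  have mi: "lk ?m i = Suc (lk b i)" "?m - unit_mon i = b"
    by (simp_all add: lookup_add)
  have other: "?t m = 0" if "m \<noteq> ?m" for m
  proof (cases "lk m i = 0")
    case False
    then have "m - unit_mon i \<noteq> b" using unit_mon_minus_plus that by metis
    then show ?thesis by (simp add: lookup_single)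
  qed simp
  have "lk (pderiv_var i p) b = (\<Sum>m\<in>Poly_Mapping.keys p. ?t m)"
    by (simp add: pderiv_var_def lookup_sum)
  also have "\<dots> = (\<Sum>m\<in>insert ?m (Poly_Mapping.keys p). ?t m)"
    by (rule sum.mono_neutral_left) (auto simp: in_keys_iff)
  also have "\<dots> = ?t ?m"
    using other by (subst sum.remove[of _ ?m]) (auto intro!: sum.neutral)
  also have "\<dots> = of_nat (Suc (lk b i)) * lk p ?m"
    by (simp only: mi lookup_single_eq)
  finally show ?thesis .
qed

lemma pderiv_var_0 [simp]: "pderiv_var i 0 = 0"
  by (rule poly_mapping_eqI) (simp add: lookup_pderiv_var)

lemma pderiv_var_add: "pderiv_var i (p + q) = pderiv_var i p + pderiv_var i q"
  by (rule poly_mapping_eqI) (simp add: lookup_pderiv_var lookup_add algebra_simps)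

lemma pderiv_var_sum: "pderiv_var i (\<Sum>x\<in>A. f x) = (\<Sum>x\<in>A. pderiv_var i (f x))"
  by (induction A rule: infinite_finite_induct) (simp_all add: pderiv_var_add)

lemma pderiv_var_single:
  "pderiv_var i (Poly_Mapping.single m c) = Poly_Mapping.single (m - unit_mon i) (of_nat (lk m i) * c)"
  by (cases "c = 0") (simp_all add: pderiv_var_def)

lemma pderiv_var_var: "pderiv_var i (var j) = (if i = j then 1 else 0)"
  by (simp add: pderiv_var_single lookup_single)

lemma pderiv_var_const [simp]: "pderiv_var i (const_pol c) = 0"
  by (simp add: const_pol_def pderiv_var_single)

lemma pderiv_var_commute: "pderiv_var i (pderiv_var j p) = pderiv_var j (pderiv_var i p)"
  by (rule poly_mapping_eqI, cases "i = j")
     (simp_all add: lookup_pderiv_var lookup_add lookup_single add_ac mult_ac)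

lemma sum_of_monomials: "p = (\<Sum>m\<in>Poly_Mapping.keys p. Poly_Mapping.single m (lk p m))"
proof (rule poly_mapping_eqI)
  fix b
  have "lk (\<Sum>m\<in>Poly_Mapping.keys p. Poly_Mapping.single m (lk p m)) b
      = (\<Sum>m\<in>Poly_Mapping.keys p. if m = b then lk p m else 0)"
    by (auto simp: lookup_sum lookup_single when_def intro: sum.cong)
  also have "\<dots> = lk p b" by (simp add: sum.delta in_keys_iff)
  finally show "lk p b = lk (\<Sum>m\<in>Poly_Mapping.keys p. Poly_Mapping.single m (lk p m)) b" by simp
qed

lemma pderiv_var_mult_single:
  fixes c d :: "'k::comm_ring_1"
  shows "pderiv_var i (Poly_Mapping.single m c * Poly_Mapping.single n d) =
   pderiv_var i (Poly_Mapping.single m c) * Poly_Mapping.single n d +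
   Poly_Mapping.single m c * pderiv_var i (Poly_Mapping.single n d)"
proof -
  have *: "Poly_Mapping.single (m + n - unit_mon i) (of_nat (lk m i) * e)
      = Poly_Mapping.single (m - unit_mon i + n) (of_nat (lk m i) * e)" for m n and e :: 'k
  proof (cases "lk m i = 0")
    case False
    then have "m + n - unit_mon i = m - unit_mon i + n"
      by (intro poly_mapping_eqI) (auto simp: lookup_add lookup_minus lookup_single when_def)
    then show ?thesis by simp
  qed simp
  have "Poly_Mapping.single (m + n - unit_mon i) (of_nat (lk (m + n) i) * (c * d))
     = Poly_Mapping.single (m + n - unit_mon i) (of_nat (lk m i) * (c * d))
     + Poly_Mapping.single (n + m - unit_mon i) (of_nat (lk n i) * (c * d))"
    by (simp add: lookup_add algebra_simps flip: single_add)
  then show ?thesis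
    unfolding * by (simp add: mult_single pderiv_var_single add_ac mult_ac)
qed

lemma pderiv_var_mult: "pderiv_var i (p * q) = pderiv_var i p * q + p * pderiv_var i q"
proof -
  let ?s = "\<lambda>p m. Poly_Mapping.single m (lk p m)"
  have "pderiv_var i (p * q)
     = pderiv_var i ((\<Sum>m\<in>Poly_Mapping.keys p. ?s p m) * (\<Sum>n\<in>Poly_Mapping.keys q. ?s q n))"
    using sum_of_monomials[of p] sum_of_monomials[of q] by simp
  also have "\<dots> = pderiv_var i (\<Sum>m\<in>Poly_Mapping.keys p. ?s p m) * (\<Sum>n\<in>Poly_Mapping.keys q. ?s q n)
      + (\<Sum>m\<in>Poly_Mapping.keys p. ?s p m) * pderiv_var i (\<Sum>n\<in>Poly_Mapping.keys q. ?s q n)"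
    by (simp add: sum_product pderiv_var_sum pderiv_var_mult_single sum.distrib)
  also have "\<dots> = pderiv_var i p * q + p * pderiv_var i q"
    using sum_of_monomials[of p] sum_of_monomials[of q] by simp
  finally show ?thesis .
qed

lemma const_pol_0 [simp]: "const_pol 0 = 0" by (simp add: const_pol_def)
lemma const_pol_1 [simp]: "const_pol 1 = 1" by (simp add: const_pol_def)
lemma const_pol_add: "const_pol (a + b) = const_pol a + const_pol b"
  by (simp add: const_pol_def single_add)
lemma const_pol_mult: "const_pol (a * b) = const_pol a * const_pol b"
  by (simp add: const_pol_def mult_single)
lemma const_pol_minus: "const_pol (- a) = - const_pol a"
  by (simp add: const_pol_def single_uminus)

lemma lookup_single_mult:
  fixes p :: "'k::comm_ring_1 mpol"
  shows "lk (Poly_Mapping.single d c * p) (d + b) = c * lk p b"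
    and "(\<nexists>b. e = d + b) \<Longrightarrow> lk (Poly_Mapping.single d c * p) e = 0"
proof -
  let ?s = "\<lambda>m. Poly_Mapping.single m (lk p m)"
  have "Poly_Mapping.single d c * p = Poly_Mapping.single d c * (\<Sum>m\<in>Poly_Mapping.keys p. ?s m)"
    using sum_of_monomials[of p] by simp
  then have eq: "Poly_Mapping.single d c * p = (\<Sum>m\<in>Poly_Mapping.keys p. Poly_Mapping.single (d + m) (c * lk p m))"
    by (simp only: sum_distrib_left mult_single)
  have "lk (Poly_Mapping.single d c * p) (d + b)
      = (\<Sum>m\<in>Poly_Mapping.keys p. if m = b then c * lk p m else 0)"
    unfolding eq lookup_sum by (rule sum.cong) (simp_all add: lookup_single when_def)
  also have "\<dots> = c * lk p b" by (simp add: sum.delta in_keys_iff)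
  finally show "lk (Poly_Mapping.single d c * p) (d + b) = c * lk p b" .
  show "lk (Poly_Mapping.single d c * p) e = 0" if "\<nexists>b. e = d + b"
    unfolding eq lookup_sum using that
    by (intro sum.neutral ballI) (metis lookup_single_not_eq)
qed

lemma lookup_const_pol_mult: "lk (const_pol c * p) b = c * lk p b"
  using lookup_single_mult(1)[of 0 c p b] by (simp add: const_pol_def)

lemma keys_single_mult:
  fixes p :: "'k::comm_ring_1 mpol"
  shows "Poly_Mapping.keys (Poly_Mapping.single d 1 * p) = (\<lambda>b. d + b) ` Poly_Mapping.keys p"
proof (rule Set.set_eqI)
  fix e
  show "e \<in> Poly_Mapping.keys (Poly_Mapping.single d 1 * p) \<longleftrightarrow> e \<in> (\<lambda>b. d + b) ` Poly_Mapping.keys p"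
  proof (cases "\<exists>b. e = d + b")
    case True
    then obtain b where "e = d + b" by blast
    then show ?thesis by (auto simp: in_keys_iff lookup_single_mult(1))
  next
    case False
    then show ?thesis using lookup_single_mult(2)[of e d 1 p] by (auto simp: in_keys_iff)
  qed
qed

text \<open>
  Here characteristic zero enters: no monomial containing the variable is lost by differentiation.
\<close>

lemma keys_pderiv_var:
  fixes p :: "'k::field_char_0 mpol"
  shows "b \<in> Poly_Mapping.keys (pderiv_var i p) \<longleftrightarrow> b + unit_mon i \<in> Poly_Mapping.keys p"
  by (simp add: in_keys_iff lookup_pderiv_var del: of_nat_Suc)

section \<open>The subrings \<open>P\<^sub>n\<close>\<close>

definition supported :: "nat \<Rightarrow> (nat \<Rightarrow>\<^sub>0 nat) \<Rightarrow> bool" where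
  "supported n a \<longleftrightarrow> Poly_Mapping.keys a \<subseteq> {..<n}"

lemma supported_iff: "supported n a \<longleftrightarrow> (\<forall>i\<ge>n. lk a i = 0)"
  unfolding supported_def subset_iff in_keys_iff lessThan_iff by (metis not_le)

lemma pol_upto_iff: "p \<in> pol_upto n \<longleftrightarrow> (\<forall>m\<in>Poly_Mapping.keys p. supported n m)"
  by (simp add: pol_upto_def supported_def)

lemma pol_upto_mono: "p \<in> pol_upto n \<Longrightarrow> n \<le> m \<Longrightarrow> p \<in> pol_upto m"
  unfolding pol_upto_iff supported_iff by (meson order_trans)

lemma pol_upto_0 [simp]: "0 \<in> pol_upto n"
  by (simp add: pol_upto_def)

lemma pol_upto_add: "p \<in> pol_upto n \<Longrightarrow> q \<in> pol_upto n \<Longrightarrow> p + q \<in> pol_upto n"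
  unfolding pol_upto_iff using keys_add[of p q] by (meson UnE subsetD)

lemma pol_upto_mult:
  fixes p q :: "'k::comm_ring_1 mpol"
  assumes "p \<in> pol_upto n" "q \<in> pol_upto n"
  shows "p * q \<in> pol_upto n"
proof -
  have "supported n m" if km: "m \<in> Poly_Mapping.keys (p * q)" for m
  proof -
    obtain a b where "a \<in> Poly_Mapping.keys p" "b \<in> Poly_Mapping.keys q" "m = a + b"
      using keys_mult[of p q] km by blast
    moreover have "supported n a" "supported n b" using calculation assms by (simp_all add: pol_upto_iff)
    ultimately show ?thesis by (simp add: supported_iff lookup_add)
  qed
  then show ?thesis by (simp add: pol_upto_iff)
qed

lemma pol_upto_single: "supported n m \<Longrightarrow> Poly_Mapping.single m c \<in> pol_upto n"
  by (simp add: pol_upto_iff)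

lemma pol_upto_const: "const_pol c \<in> pol_upto n"
  unfolding const_pol_def by (rule pol_upto_single) (simp add: supported_iff)

lemma pol_upto_uminus:
  fixes p :: "'k::comm_ring_1 mpol"
  shows "p \<in> pol_upto n \<Longrightarrow> - p \<in> pol_upto n"
  by (simp add: pol_upto_iff in_keys_iff)

lemma pol_upto_diff:
  fixes p q :: "'k::comm_ring_1 mpol"
  shows "p \<in> pol_upto n \<Longrightarrow> q \<in> pol_upto n \<Longrightarrow> p - q \<in> pol_upto n"
  using pol_upto_add[of p n "- q"] pol_upto_uminus[of q n] by simp

lemma pol_upto_sum: "(\<And>x. x \<in> A \<Longrightarrow> f x \<in> pol_upto n) \<Longrightarrow> sum f A \<in> pol_upto n"
  by (induction A rule: infinite_finite_induct) (simp_all add: pol_upto_add)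

lemma pderiv_var_eq_0:
  fixes p :: "'k::comm_ring_1 mpol"
  assumes "p \<in> pol_upto n" "n \<le> i"
  shows "pderiv_var i p = 0"
proof (rule poly_mapping_eqI)
  fix b
  have "lk (b + unit_mon i) i \<noteq> 0" by (simp add: lookup_add)
  then have "\<not> supported n (b + unit_mon i)" using assms(2) by (metis supported_iff)
  then have "lk p (b + unit_mon i) = 0" using assms(1) by (metis pol_upto_iff in_keys_iff)
  then show "lk (pderiv_var i p) b = lk 0 b" by (simp add: lookup_pderiv_var)
qed

lemma pol_upto_pderiv_var:
  fixes p :: "'k::comm_ring_1 mpol"
  assumes "p \<in> pol_upto n"
  shows "pderiv_var i p \<in> pol_upto n"
proof -
  have "supported n b" if "b \<in> Poly_Mapping.keys (pderiv_var i p)" for b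
  proof -
    have "b + unit_mon i \<in> Poly_Mapping.keys p"
      using that unfolding in_keys_iff lookup_pderiv_var by fastforce
    then have "supported n (b + unit_mon i)" using assms by (simp add: pol_upto_iff)
    then show ?thesis by (simp add: supported_iff lookup_add)
  qed
  then show ?thesis by (simp add: pol_upto_iff)
qed

lemma antiderivative:
  fixes p :: "'k::field_char_0 mpol"
  assumes "p \<in> pol_upto n" "i < n"
  obtains q where "q \<in> pol_upto n" "pderiv_var i q = p"
proof
  let ?q = "\<Sum>m\<in>Poly_Mapping.keys p. Poly_Mapping.single (m + unit_mon i) (lk p m / of_nat (Suc (lk m i)))"
  show "?q \<in> pol_upto n"
  proof (intro pol_upto_sum pol_upto_single)
    fix m assume "m \<in> Poly_Mapping.keys p"
    then have "supported n m" using assms(1) by (simp add: pol_upto_iff)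
    then show "supported n (m + unit_mon i)"
      using assms(2) by (simp add: supported_iff lookup_add lookup_single)
  qed
  have "of_nat (lk (m + unit_mon i) i) * (lk p m / of_nat (Suc (lk m i))) = lk p m" for m
    by (simp add: lookup_add del: of_nat_Suc)
  then show "pderiv_var i ?q = p"
    using sum_of_monomials[of p] by (simp add: pderiv_var_sum pderiv_var_single del: of_nat_Suc)
qed

section \<open>Colexicographic comparison of monomials\<close>

abbreviation mon_less :: "(nat \<Rightarrow>\<^sub>0 nat) \<Rightarrow> (nat \<Rightarrow>\<^sub>0 nat) \<Rightarrow> bool" (infix \<open>\<prec>\<close> 50) where
  "a \<prec> b \<equiv> colex (lk a) (lk b)"

abbreviation mon_le :: "(nat \<Rightarrow>\<^sub>0 nat) \<Rightarrow> (nat \<Rightarrow>\<^sub>0 nat) \<Rightarrow> bool" (infix \<open>\<preceq>\<close> 50) where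
  "a \<preceq> b \<equiv> a = b \<or> a \<prec> b"

lemma lookup_finsupp [simp]: "lk a \<in> finsupp"
  by (simp add: finsupp_def)

lemma mon_total: "a = b \<or> a \<prec> b \<or> b \<prec> a"
  using colex_total[of "lk a" "lk b"] by (metis poly_mapping_eqI lookup_finsupp)

lemma mon_le_if_lookup_le: "(\<And>k. lk a k \<le> lk b k) \<Longrightarrow> a \<preceq> b"
  using colex_if_le[of "lk a" "lk b"] by (metis poly_mapping_eqI lookup_finsupp)

lemma not_mon_less_0: "\<not> a \<prec> 0"
  by (simp add: colex_def)

lemma mon_add_less: "a \<prec> b \<Longrightarrow> c + a \<prec> c + b"
  by (simp add: colex_def lookup_add)

lemma mon_add_less_cancel: "a + c \<prec> b + c \<longleftrightarrow> a \<prec> b"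
  by (simp add: colex_def lookup_add)

lemma wfP_mon_less: "wfp (\<prec>)"
  unfolding wfp_iff_ex_minimal
proof (intro allI impI)
  fix B :: "(nat \<Rightarrow>\<^sub>0 nat) set" assume "B \<noteq> {}"
  then have "lk ` B \<subseteq> finsupp" "lk ` B \<noteq> {}" by auto
  then obtain f where f: "f \<in> lk ` B" "\<forall>g\<in>lk ` B. f = g \<or> colex f g" using colex_least by meson
  then obtain z where "z \<in> B" "f = lk z" by blast
  then have "\<forall>y. y \<prec> z \<longrightarrow> y \<notin> B" using f(2) colex_asym colex_irrefl by (metis image_eqI)
  then show "\<exists>z\<in>B. \<forall>y. y \<prec> z \<longrightarrow> y \<notin> B" using \<open>z \<in> B\<close> by blast
qed

lemma mon_max_exists:
  assumes "finite A" "A \<noteq> {}"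
  shows "\<exists>a\<in>A. \<forall>b\<in>A. b \<preceq> a"
  using assms
proof (induction A rule: finite_ne_induct)
  case (insert x A)
  then obtain a where "a \<in> A" "\<forall>b\<in>A. b \<preceq> a" by blast
  then show ?case using mon_total[of a x] colex_trans[of _ "lk a" "lk x"] by (metis insert_iff)
qed auto

section \<open>Triangular derivations\<close>

text \<open>
  The carrier of \<open>\<uu>\<^sub>\<infinity>\<close>. Since \<open>\<uu>\<^sub>n \<subseteq> \<uu>\<^sub>n\<^sub>+\<^sub>1\<close>, it does not matter where the union starts.
\<close>

definition triang :: "('k::field_char_0 mpol \<Rightarrow> 'k mpol) set" where
  "triang = (\<Union>n. u_fin n)"

abbreviation bracket :: "('a::ab_group_add \<Rightarrow> 'a) \<Rightarrow> ('a \<Rightarrow> 'a) \<Rightarrow> 'a \<Rightarrow> 'a" where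
  "bracket D E \<equiv> (\<lambda>f. D (E f) - E (D f))"

lemma triangI: "(\<And>i. i < n \<Longrightarrow> a i \<in> pol_upto i) \<Longrightarrow> (\<lambda>f. \<Sum>i<n. a i * pderiv_var i f) \<in> triang"
  by (auto simp: triang_def u_fin_def)

lemma carrier_u_infinity:
  "carrier u_infinity = (triang :: ('k::field_char_0 mpol \<Rightarrow> 'k mpol) set)"
proof -
  have "u_fin n \<subseteq> (u_fin (Suc (Suc n)) :: ('k mpol \<Rightarrow> 'k mpol) set)" for n
  proof
    fix D :: "'k mpol \<Rightarrow> 'k mpol" assume "D \<in> u_fin n"
    then obtain a where a: "\<forall>i<n. a i \<in> pol_upto i" "D = (\<lambda>f. \<Sum>i<n. a i * pderiv_var i f)"
      by (auto simp: u_fin_def)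
    let ?b = "\<lambda>i. if i < n then a i else 0"
    have "D = (\<lambda>f. \<Sum>i<Suc (Suc n). ?b i * pderiv_var i f)" using a(2) by simp
    moreover have "\<forall>i<Suc (Suc n). ?b i \<in> pol_upto i" using a(1) by simp
    ultimately show "D \<in> u_fin (Suc (Suc n))" unfolding u_fin_def mem_Collect_eq
      by (intro exI[of _ ?b] conjI)
  qed
  then have sub: "u_fin n \<subseteq> (\<Union>n\<in>{2..}. u_fin n :: ('k mpol \<Rightarrow> 'k mpol) set)" for n
    by (rule subset_trans) (rule UN_upper, simp)
  have "(\<Union>n\<in>{2..}. u_fin n) = (\<Union>n. u_fin n :: ('k mpol \<Rightarrow> 'k mpol) set)"
    by (rule subset_antisym) (rule UN_mono, simp, rule subset_refl, rule UN_least, rule sub)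
  then show ?thesis unfolding u_infinity_def triang_def by simp
qed

text \<open>
  The coefficient of \<open>\<partial>\<^sub>i\<close> in \<open>D\<close> is \<open>D\<close> applied to the variable \<open>i\<close>. Hence \<open>D (var i)\<close> serves as the
  coordinate function below, and no separate sequence of coefficients has to be carried along.
\<close>

lemma triang_expansion:
  assumes "D \<in> triang"
  shows "\<exists>N. (\<forall>i\<ge>N. D (var i) = 0) \<and>
    (\<forall>n\<ge>N. \<forall>f. D f = (\<Sum>i<n. D (var i) * pderiv_var i f)) \<and> (\<forall>i. D (var i) \<in> pol_upto i)"
proof -
  obtain n a where a: "\<forall>i<n. a i \<in> pol_upto i" "D = (\<lambda>f. \<Sum>i<n. a i * pderiv_var i f)"
    using assms by (auto simp: triang_def u_fin_def)
  have c: "D (var j) = (if j < n then a j else 0)" for j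
    unfolding a(2) pderiv_var_var by (simp add: if_distrib[of "(*) _"] sum.delta cong: if_cong)
  show ?thesis
  proof (intro exI[of _ n] conjI allI impI)
    show "D (var i) = 0" if "n \<le> i" for i using c that by simp
    show "D (var i) \<in> pol_upto i" for i using c a(1) by simp
    show "D f = (\<Sum>i<m. D (var i) * pderiv_var i f)" if "n \<le> m" for m f
    proof -
      have "D f = (\<Sum>i<n. D (var i) * pderiv_var i f)"
        using c by (subst a(2)) simp
      also have "\<dots> = (\<Sum>i<m. D (var i) * pderiv_var i f)"
        by (rule sum.mono_neutral_left) (use that c in auto)
      finally show ?thesis .
    qed
  qed
qed

lemma triang_common_expansion:
  assumes "D \<in> triang" "E \<in> triang"
  shows "\<exists>n. (\<forall>f. D f = (\<Sum>i<n. D (var i) * pderiv_var i f)) \<and>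
    (\<forall>f. E f = (\<Sum>i<n. E (var i) * pderiv_var i f))"
proof -
  obtain N where N: "\<forall>n\<ge>N. \<forall>f. D f = (\<Sum>i<n. D (var i) * pderiv_var i f)"
    using triang_expansion[OF assms(1)] by (elim exE conjE)
  obtain M where M: "\<forall>n\<ge>M. \<forall>f. E f = (\<Sum>i<n. E (var i) * pderiv_var i f)"
    using triang_expansion[OF assms(2)] by (elim exE conjE)
  show ?thesis
    by (intro exI[of _ "max N M"] conjI allI) (rule N[rule_format] M[rule_format], simp)+
qed

lemma triang_finite_expansion:
  assumes "D \<in> triang"
  shows "\<exists>n. \<forall>f. D f = (\<Sum>i<n. D (var i) * pderiv_var i f)"
  using triang_common_expansion[OF assms assms] by (elim exE conjE) (rule exI)

lemma triang_coeff: "D \<in> triang \<Longrightarrow> D (var i) \<in> pol_upto i"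
  apply (drule triang_expansion) by (elim exE conjE) simp

lemma triang_coeff_vanish: "D \<in> triang \<Longrightarrow> \<exists>N. \<forall>i\<ge>N. D (var i) = 0"
  apply (drule triang_expansion) by (elim exE conjE) (rule exI)

lemma triang_eqI:
  assumes "D \<in> triang" "E \<in> triang" "\<And>i. D (var i) = E (var i)"
  shows "D = E"
proof
  fix f
  obtain n where n: "\<forall>f. D f = (\<Sum>i<n. D (var i) * pderiv_var i f)"
    "\<forall>f. E f = (\<Sum>i<n. E (var i) * pderiv_var i f)"
    using triang_common_expansion[OF assms(1,2)] by (elim exE conjE)
  show "D f = E f"
    by (rule trans[OF n(1)[rule_format] trans[OF _ n(2)[rule_format, symmetric]]]) (simp only: assms(3))
qed

lemma triang_add:
  assumes "D \<in> triang" shows "D (f + g) = D f + D g"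
proof -
  obtain n where n: "\<forall>f. D f = (\<Sum>i<n. D (var i) * pderiv_var i f)"
    using triang_finite_expansion[OF assms] by (elim exE)
  show ?thesis
    using n[rule_format, of "f + g"] n[rule_format, of f] n[rule_format, of g] by (simp add: pderiv_var_add distrib_left sum.distrib)
qed

lemma triang_mult:
  assumes "D \<in> triang" shows "D (f * g) = D f * g + f * D g"
proof -
  obtain n where n: "\<forall>f. D f = (\<Sum>i<n. D (var i) * pderiv_var i f)"
    using triang_finite_expansion[OF assms] by (elim exE)
  show ?thesis
    using n[rule_format, of "f * g"] n[rule_format, of f] n[rule_format, of g]
    by (simp add: pderiv_var_mult algebra_simps sum.distrib sum_distrib_left)
qed

lemma triang_const:
  assumes "D \<in> triang" shows "D (const_pol c) = 0"
proof -
  obtain n where n: "\<forall>f. D f = (\<Sum>i<n. D (var i) * pderiv_var i f)"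
    using triang_finite_expansion[OF assms] by (elim exE)
  show ?thesis using n[rule_format, of "const_pol c"] by simp
qed

lemma triang_0: "D \<in> triang \<Longrightarrow> D 0 = 0"
  using triang_const[of D 0] by simp

lemma triang_const_mult: "D \<in> triang \<Longrightarrow> D (const_pol c * f) = const_pol c * D f"
  by (simp add: triang_mult triang_const)

lemma triang_uminus: "D \<in> triang \<Longrightarrow> D (- f) = - D f"
  using triang_add[of D f "- f"] triang_0[of D] by (simp add: eq_neg_iff_add_eq_0 add.commute)

lemma triang_diff: "D \<in> triang \<Longrightarrow> D (f - g) = D f - D g"
  using triang_add[of D f "- g"] by (simp add: triang_uminus)

lemma triang_sum: "D \<in> triang \<Longrightarrow> D (sum g A) = (\<Sum>x\<in>A. D (g x))"
  by (induction A rule: infinite_finite_induct) (simp_all add: triang_add triang_0)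

lemma triang_pol_upto:
  assumes "D \<in> triang" "p \<in> pol_upto n"
  shows "D p \<in> pol_upto n"
proof -
  obtain m where m: "\<forall>f. D f = (\<Sum>i<m. D (var i) * pderiv_var i f)"
    using triang_finite_expansion[OF assms(1)] by (elim exE)
  have "D (var i) * pderiv_var i p \<in> pol_upto n" for i
  proof (cases "i < n")
    case True
    then show ?thesis
      using pol_upto_mono[OF triang_coeff[OF assms(1)], of i n]
      by (intro pol_upto_mult pol_upto_pderiv_var assms) simp
  next
    case False
    then show ?thesis using pderiv_var_eq_0[OF assms(2)] by simp
  qed
  then show ?thesis by (subst m[rule_format]) (rule pol_upto_sum)
qed

section \<open>The Lie algebra \<open>\<uu>\<^sub>\<infinity>\<close>\<close>

lemma zero_triang: "(\<lambda>f. 0) \<in> triang"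
  using triangI[of 0] by simp

lemma add_triang:
  assumes "D \<in> triang" "E \<in> triang"
  shows "(\<lambda>f. D f + E f) \<in> triang"
proof -
  obtain n where n: "\<forall>f. D f = (\<Sum>i<n. D (var i) * pderiv_var i f)"
    "\<forall>f. E f = (\<Sum>i<n. E (var i) * pderiv_var i f)"
    using triang_common_expansion[OF assms] by (elim exE conjE)
  have "D f + E f = (\<Sum>i<n. (D (var i) + E (var i)) * pderiv_var i f)" for f
    using n(1)[rule_format, of f] n(2)[rule_format, of f] by (simp add: algebra_simps sum.distrib)
  then have eq: "(\<lambda>f. D f + E f) = (\<lambda>f. \<Sum>i<n. (D (var i) + E (var i)) * pderiv_var i f)"
    by (rule ext)
  show ?thesis by (subst eq) (intro triangI pol_upto_add triang_coeff assms)
qed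

lemma const_mult_triang:
  assumes "D \<in> triang"
  shows "(\<lambda>f. const_pol c * D f) \<in> triang"
proof -
  obtain n where n: "\<forall>f. D f = (\<Sum>i<n. D (var i) * pderiv_var i f)"
    using triang_finite_expansion[OF assms] by (elim exE)
  have "const_pol c * D f = (\<Sum>i<n. (const_pol c * D (var i)) * pderiv_var i f)" for f
    using n[rule_format, of f] by (simp add: sum_distrib_left mult.assoc)
  then have eq: "(\<lambda>f. const_pol c * D f) = (\<lambda>f. \<Sum>i<n. (const_pol c * D (var i)) * pderiv_var i f)"
    by (rule ext)
  show ?thesis by (subst eq) (intro triangI pol_upto_mult pol_upto_const triang_coeff assms)
qed

text \<open>
  The second order terms of \<open>DE\<close> and \<open>ED\<close> agree because partial derivatives commute, and the
  coefficients stay triangular because a triangular derivation maps every \<open>P\<^sub>n\<close> into itself.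
\<close>

lemma bracket_triang:
  assumes "D \<in> triang" "E \<in> triang"
  shows "bracket D E \<in> triang"
proof -
  obtain n where n: "\<forall>f. D f = (\<Sum>i<n. D (var i) * pderiv_var i f)"
    "\<forall>f. E f = (\<Sum>i<n. E (var i) * pderiv_var i f)"
    using triang_common_expansion[OF assms] by (elim exE conjE)
  have DE: "D (E f) = (\<Sum>i<n. D (E (var i)) * pderiv_var i f)
        + (\<Sum>i<n. \<Sum>j<n. E (var i) * D (var j) * pderiv_var j (pderiv_var i f))" for f
  proof -
    have "D (E f) = (\<Sum>i<n. D (E (var i) * pderiv_var i f))"
      by (subst n(2)[rule_format]) (rule triang_sum[OF assms(1)])
    also have "\<dots> = (\<Sum>i<n. D (E (var i)) * pderiv_var i f) + (\<Sum>i<n. E (var i) * D (pderiv_var i f))"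
      by (simp add: triang_mult[OF assms(1)] sum.distrib)
    also have "(\<Sum>i<n. E (var i) * D (pderiv_var i f))
        = (\<Sum>i<n. \<Sum>j<n. E (var i) * D (var j) * pderiv_var j (pderiv_var i f))"
      by (rule sum.cong[OF refl], subst n(1)[rule_format]) (simp add: sum_distrib_left mult.assoc)
    finally show ?thesis .
  qed
  have ED: "E (D f) = (\<Sum>i<n. E (D (var i)) * pderiv_var i f)
        + (\<Sum>i<n. \<Sum>j<n. D (var i) * E (var j) * pderiv_var j (pderiv_var i f))" for f
  proof -
    have "E (D f) = (\<Sum>i<n. E (D (var i) * pderiv_var i f))"
      by (subst n(1)[rule_format]) (rule triang_sum[OF assms(2)])
    also have "\<dots> = (\<Sum>i<n. E (D (var i)) * pderiv_var i f) + (\<Sum>i<n. D (var i) * E (pderiv_var i f))"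
      by (simp add: triang_mult[OF assms(2)] sum.distrib)
    also have "(\<Sum>i<n. D (var i) * E (pderiv_var i f))
        = (\<Sum>i<n. \<Sum>j<n. D (var i) * E (var j) * pderiv_var j (pderiv_var i f))"
      by (rule sum.cong[OF refl], subst n(2)[rule_format]) (simp add: sum_distrib_left mult.assoc)
    finally show ?thesis .
  qed
  have swap: "(\<Sum>i<n. \<Sum>j<n. E (var i) * D (var j) * pderiv_var j (pderiv_var i f))
       = (\<Sum>i<n. \<Sum>j<n. D (var i) * E (var j) * pderiv_var j (pderiv_var i f))" for f
    by (subst sum.swap) (simp only: pderiv_var_commute mult.commute)
  have "bracket D E f = (\<Sum>i<n. bracket D E (var i) * pderiv_var i f)" for f
    unfolding DE[of f] ED[of f] swap by (simp add: left_diff_distrib sum_subtractf)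
  then have eq: "bracket D E = (\<lambda>f. \<Sum>i<n. bracket D E (var i) * pderiv_var i f)" by (rule ext)
  have "bracket D E (var i) \<in> pol_upto i" for i
    using triang_pol_upto[OF assms(1) triang_coeff[OF assms(2)]]
      triang_pol_upto[OF assms(2) triang_coeff[OF assms(1)]] by (intro pol_upto_diff)
  then show ?thesis by (subst eq) (rule triangI)
qed

lemma lie_algebra_u_infinity:
  "lie_algebra (ring_of_type_algebra :: 'k::field_char_0 ring) u_infinity"
proof -
  let ?K = "ring_of_type_algebra :: 'k ring"
  let ?G = "u_infinity :: ('k, 'k mpol \<Rightarrow> 'k mpol) module"
  interpret K: field ?K by (rule field_from_type_algebra)
  have car: "carrier ?G = triang" by (rule carrier_u_infinity)
  have ops: "add ?G D E = (\<lambda>f. D f + E f)" "\<zero>\<^bsub>?G\<^esub> = (\<lambda>f. 0)" "D \<otimes>\<^bsub>?G\<^esub> E = bracket D E"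
    "c \<odot>\<^bsub>?G\<^esub> D = (\<lambda>f. const_pol c * D f)" for D E c
    by (simp_all add: u_infinity_def)
  have opK: "carrier ?K = UNIV" "add ?K = (+)" "monoid.mult ?K = (*)" "one ?K = 1"
    by (simp_all add: ring_of_type_algebra_def)
  have "abelian_group ?G"
  proof (rule abelian_groupI)
    fix x assume "x \<in> carrier ?G"
    then have "(\<lambda>f. const_pol (- 1) * x f) \<in> carrier ?G" by (simp add: car const_mult_triang)
    moreover have "add ?G (\<lambda>f. const_pol (- 1) * x f) x = \<zero>\<^bsub>?G\<^esub>"
      by (simp add: ops const_pol_minus)
    ultimately show "\<exists>y\<in>carrier ?G. y \<oplus>\<^bsub>?G\<^esub> x = \<zero>\<^bsub>?G\<^esub>" by blast
  qed (simp_all add: car ops add_triang zero_triang add_ac)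
  then have "module ?K ?G"
    by (intro moduleI K.is_cring)
       (simp_all add: car ops opK const_mult_triang const_pol_add const_pol_mult distrib_left distrib_right mult.assoc)
  then show ?thesis
    unfolding lie_algebra_def lie_algebra_axioms_def
    by (simp add: K.field_axioms car ops opK bracket_triang triang_add triang_diff
        triang_const_mult right_diff_distrib add_diff_add)
qed

abbreviation tri_ideal :: "('k::field_char_0 mpol \<Rightarrow> 'k mpol) set \<Rightarrow> bool" where
  "tri_ideal \<equiv> lie_ideal ring_of_type_algebra u_infinity"

lemma tri_ideal_iff:
  "tri_ideal I \<longleftrightarrow> I \<subseteq> triang \<and> (\<lambda>f. 0) \<in> I \<and> (\<forall>D\<in>I. \<forall>E\<in>I. (\<lambda>f. D f + E f) \<in> I) \<and>
    (\<forall>c. \<forall>D\<in>I. (\<lambda>f. const_pol c * D f) \<in> I) \<and> (\<forall>D\<in>triang. \<forall>E\<in>I. bracket D E \<in> I)"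
  (is "_ \<longleftrightarrow> ?R") for I :: "('k::field_char_0 mpol \<Rightarrow> 'k mpol) set"
proof -
  let ?K = "ring_of_type_algebra :: 'k ring"
  let ?G = "u_infinity :: ('k, 'k mpol \<Rightarrow> 'k mpol) module"
  interpret lie_algebra ?K ?G by (rule lie_algebra_u_infinity)
  have car: "carrier ?G = triang" by (rule carrier_u_infinity)
  have ops: "add ?G D E = (\<lambda>f. D f + E f)" "\<zero>\<^bsub>?G\<^esub> = (\<lambda>f. 0)" "D \<otimes>\<^bsub>?G\<^esub> E = bracket D E"
    "c \<odot>\<^bsub>?G\<^esub> D = (\<lambda>f. const_pol c * D f)" for D E c
    by (simp_all add: u_infinity_def)
  have carK: "carrier ?K = UNIV" by (simp add: ring_of_type_algebra_def)
  show ?thesis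
  proof
    assume I: "tri_ideal I"
    then have sub: "submodule I ?K ?G" by (simp add: lie_ideal_def)
    note E = submoduleE[OF sub, unfolded car carK ops]
    have "\<zero>\<^bsub>?G\<^esub> \<in> I"
      using subgroup.one_closed[OF submodule.axioms(1)[OF sub]] by simp
    then show ?R using E(1,4,5) I by (auto simp: lie_ideal_def car ops)
  next
    assume R: ?R
    have "submodule I ?K ?G"
    proof (rule submoduleI)
      fix D assume D: "D \<in> I"
      then have "D \<in> carrier ?G" using R car by blast
      then have "\<ominus>\<^bsub>?G\<^esub> D = (\<ominus>\<^bsub>?K\<^esub> \<one>\<^bsub>?K\<^esub>) \<odot>\<^bsub>?G\<^esub> D"
        using smult_l_minus[of "\<one>\<^bsub>?K\<^esub>" D] by simp
      then show "\<ominus>\<^bsub>?G\<^esub> D \<in> I" using R D by (simp add: ops)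
    qed (use R in \<open>auto simp: car ops\<close>)
    then show "tri_ideal I" using R by (simp add: lie_ideal_def car ops)
  qed
qed

lemma
  assumes "tri_ideal I"
  shows tri_ideal_subset: "I \<subseteq> triang"
    and tri_ideal_zero: "(\<lambda>f. 0) \<in> I"
    and tri_ideal_add: "\<And>D E. D \<in> I \<Longrightarrow> E \<in> I \<Longrightarrow> (\<lambda>f. D f + E f) \<in> I"
    and tri_ideal_const_mult: "\<And>c D. D \<in> I \<Longrightarrow> (\<lambda>f. const_pol c * D f) \<in> I"
    and tri_ideal_bracket: "\<And>D E. D \<in> triang \<Longrightarrow> E \<in> I \<Longrightarrow> bracket D E \<in> I"
  using assms unfolding tri_ideal_iff by blast+

lemma tri_ideal_bracket':
  assumes "tri_ideal I" "D \<in> I" "E \<in> triang"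
  shows "bracket D E \<in> I"
proof -
  have "(\<lambda>f. const_pol (- 1) * bracket E D f) \<in> I"
    using assms by (intro tri_ideal_const_mult tri_ideal_bracket)
  then show ?thesis by (simp add: const_pol_minus)
qed

definition coord_der :: "'k::field_char_0 mpol \<Rightarrow> nat \<Rightarrow> 'k mpol \<Rightarrow> 'k mpol" where
  "coord_der a k = (\<lambda>f. a * pderiv_var k f)"

lemma coord_der_triang:
  assumes "a \<in> pol_upto k"
  shows "coord_der a k \<in> triang"
proof -
  have "(\<lambda>f. \<Sum>i<Suc k. (if i = k then a else 0) * pderiv_var i f) \<in> triang"
    by (rule triangI) (use assms in auto)
  moreover have "(\<Sum>i<Suc k. (if i = k then a else 0) * pderiv_var i f) = a * pderiv_var k f" for f
    by simp
  ultimately show ?thesis by (simp add: coord_der_def)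
qed

lemma coord_der_var: "coord_der a k (var l) = (if l = k then a else 0)"
  unfolding coord_der_def pderiv_var_var by auto

section \<open>Leading terms\<close>

text \<open>
  The ideal \<open>\<Oplus>\<^bsub>j \<ge> i\<^esub> P\<^sub>j \<partial>\<^sub>j\<close> (indices starting at \<open>0\<close>). These are the terms of the derived series.
\<close>

definition tail :: "nat \<Rightarrow> ('k::field_char_0 mpol \<Rightarrow> 'k mpol) set" where
  "tail i = {D \<in> triang. \<forall>j<i. D (var j) = 0}"

text \<open>
  The leading term of \<open>D\<close> is \<open>x\<^sup>a \<partial>\<^sub>i\<close>. The smallest index \<open>i\<close> leads because brackets push coefficients
  towards larger indices, and the highest variable is the most significant one because
  \<open>x\<^sup>d \<partial>\<^sub>k\<close> trades one power of the variable \<open>k\<close> for arbitrary powers of smaller variables.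
\<close>

definition has_lead :: "('k::field_char_0 mpol \<Rightarrow> 'k mpol) \<Rightarrow> nat \<Rightarrow> (nat \<Rightarrow>\<^sub>0 nat) \<Rightarrow> bool" where
  "has_lead D i a \<longleftrightarrow> D \<in> tail i \<and> a \<in> Poly_Mapping.keys (D (var i)) \<and>
    (\<forall>b\<in>Poly_Mapping.keys (D (var i)). b \<preceq> a)"

lemma mon_le_trans: "a \<preceq> b \<Longrightarrow> b \<preceq> c \<Longrightarrow> a \<preceq> c"
  using colex_trans by metis

lemma tailI: "D \<in> triang \<Longrightarrow> (\<And>j. j < i \<Longrightarrow> D (var j) = 0) \<Longrightarrow> D \<in> tail i"
  by (simp add: tail_def)

lemma tail_triang: "D \<in> tail i \<Longrightarrow> D \<in> triang"
  by (simp add: tail_def)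

lemma tail_var: "D \<in> tail i \<Longrightarrow> j < i \<Longrightarrow> D (var j) = 0"
  by (simp add: tail_def)

lemma tail_antimono: "i \<le> j \<Longrightarrow> tail j \<subseteq> tail i"
  by (auto simp: tail_def)

lemma tail_pol_upto_Suc:
  assumes D: "D \<in> tail k" and p: "p \<in> pol_upto (Suc k)"
  shows "D p = D (var k) * pderiv_var k p"
proof -
  obtain N where N: "\<forall>n\<ge>N. \<forall>f. D f = (\<Sum>i<n. D (var i) * pderiv_var i f)"
    using triang_expansion[OF tail_triang[OF D]] by (elim exE conjE)
  let ?n = "max N (Suc k)"
  have "D p = (\<Sum>i<?n. D (var i) * pderiv_var i p)" by (rule N[rule_format]) simp
  also have "\<dots> = (\<Sum>i\<in>{k}. D (var i) * pderiv_var i p)"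
  proof (rule sum.mono_neutral_right)
    show "\<forall>i\<in>{..<?n} - {k}. D (var i) * pderiv_var i p = 0"
    proof
      fix i assume "i \<in> {..<?n} - {k}"
      then consider "i < k" | "Suc k \<le> i" by force
      then show "D (var i) * pderiv_var i p = 0"
        by cases (simp_all add: tail_var[OF D] pderiv_var_eq_0[OF p])
    qed
  qed auto
  finally show ?thesis by simp
qed

lemma tail_pol_upto:
  assumes "D \<in> tail k" "p \<in> pol_upto k"
  shows "D p = 0"
proof -
  have "p \<in> pol_upto (Suc k)" by (rule pol_upto_mono[OF assms(2)]) simp
  then show ?thesis
    using tail_pol_upto_Suc[OF assms(1)] pderiv_var_eq_0[OF assms(2)] by simp
qed

lemma tail_Suc: "D \<in> tail i \<Longrightarrow> D (var i) = 0 \<Longrightarrow> D \<in> tail (Suc i)"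
  by (simp add: tail_def less_Suc_eq)

lemma has_lead_supported: "has_lead D i a \<Longrightarrow> supported i a"
  using triang_coeff[of D i] by (simp add: has_lead_def tail_def pol_upto_iff)

lemma tail_lead_exists:
  assumes "D \<in> tail i" "D (var i) \<noteq> 0"
  shows "\<exists>a. has_lead D i a"
proof -
  have "Poly_Mapping.keys (D (var i)) \<noteq> {}" using assms(2) by simp
  then obtain a where "a \<in> Poly_Mapping.keys (D (var i))" "\<forall>b\<in>Poly_Mapping.keys (D (var i)). b \<preceq> a"
    using mon_max_exists[OF finite_keys] by metis
  then show ?thesis using assms(1) unfolding has_lead_def by metis
qed

lemma has_lead_exists:
  assumes D: "D \<in> triang" and nz: "D \<noteq> (\<lambda>f. 0)"
  shows "\<exists>i a. has_lead D i a"
proof -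
  have ex: "\<exists>i. D (var i) \<noteq> 0"
  proof (rule ccontr)
    assume "\<nexists>i. D (var i) \<noteq> 0"
    then have "D = (\<lambda>f. 0)" by (intro triang_eqI[OF D zero_triang]) simp
    with nz show False by simp
  qed
  define i where "i = (LEAST i. D (var i) \<noteq> 0)"
  have "D (var i) \<noteq> 0" unfolding i_def by (rule LeastI_ex[OF ex])
  moreover have "D (var j) = 0" if "j < i" for j
    using not_less_Least that unfolding i_def by blast
  then have "D \<in> tail i" by (intro tailI D)
  ultimately show ?thesis using tail_lead_exists by metis
qed

lemma triang_exists:
  assumes "\<And>i. b i \<in> pol_upto i" "\<And>i. N \<le> i \<Longrightarrow> b i = 0"
  shows "\<exists>D\<in>triang. \<forall>i. D (var i) = b i"
proof (rule bexI)
  show "(\<lambda>f. \<Sum>i<N. b i * pderiv_var i f) \<in> triang" by (rule triangI) (rule assms(1))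
  show "\<forall>i. (\<Sum>j<N. b j * pderiv_var j (var i)) = b i"
    using assms(2) unfolding pderiv_var_var
    by (simp add: if_distrib[of "(*) _"] sum.delta cong: if_cong)
qed

text \<open>
  Differentiating and multiplying by a monomial both preserve the comparison of monomials, so the
  leading term is transformed like a single monomial.
\<close>

lemma has_lead_bracket:
  assumes lead: "has_lead D i a" and k: "lk a k \<noteq> 0" and d: "supported k d"
  shows "has_lead (bracket (coord_der (Poly_Mapping.single d 1) k) D) i (d + (a - unit_mon k))"
proof -
  let ?s = "Poly_Mapping.single d 1 :: 'a mpol"
  let ?C = "coord_der ?s k"
  let ?B = "bracket ?C D"
  have D: "D \<in> tail i" "D \<in> triang" using lead by (auto simp: has_lead_def tail_def)
  have "k < i" using has_lead_supported[OF lead] k unfolding supported_iff by (meson not_le)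
  have s: "?s \<in> pol_upto k" by (rule pol_upto_single[OF d])
  have C: "?C \<in> triang" by (rule coord_der_triang[OF s])
  have "D ?s = 0" by (rule tail_pol_upto[OF D(1) pol_upto_mono[OF s]]) (use \<open>k < i\<close> in simp)
  then have "D (?C (var j)) = 0" for j by (simp add: coord_der_var triang_0[OF D(2)])
  then have B: "?B (var j) = ?s * pderiv_var k (D (var j))" for j by (simp add: coord_der_def)
  have "?B \<in> tail i"
    by (rule tailI[OF bracket_triang[OF C D(2)]], subst B, subst tail_var[OF D(1)]) simp_all
  moreover have keys: "Poly_Mapping.keys (?B (var i))
      = (\<lambda>b. d + b) ` {b. b + unit_mon k \<in> Poly_Mapping.keys (D (var i))}"
    unfolding B keys_single_mult using keys_pderiv_var by (metis (no_types, lifting) Collect_cong Collect_mem_eq)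
  moreover have "d + (a - unit_mon k) \<in> Poly_Mapping.keys (?B (var i))"
    unfolding keys using lead unit_mon_minus_plus[OF k] by (intro imageI) (simp add: has_lead_def)
  moreover have "c \<preceq> d + (a - unit_mon k)" if c: "c \<in> Poly_Mapping.keys (?B (var i))" for c
  proof -
    obtain b where b: "c = d + b" "b + unit_mon k \<in> Poly_Mapping.keys (D (var i))"
      using c unfolding keys by blast
    then have "b + unit_mon k \<preceq> a - unit_mon k + unit_mon k"
      using lead unit_mon_minus_plus[OF k] by (simp add: has_lead_def)
    then have "b \<preceq> a - unit_mon k" unfolding mon_add_less_cancel by simp
    then show ?thesis using b(1) mon_add_less by metis
  qed
  ultimately show ?thesis by (simp only: has_lead_def) simp
qed

lemma truncated_mon_exists: "\<exists>d. supported k d \<and> (\<forall>l<k. lk d l = lk b l)"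
proof -
  let ?f = "\<lambda>l. if l < k then lk b l else 0"
  have "finite {l. ?f l \<noteq> 0}" by (rule finite_subset[of _ "{..<k}"]) auto
  then have "lk (Poly_Mapping.Abs_poly_mapping ?f) = ?f" by (rule lookup_Abs_poly_mapping)
  then show ?thesis
    by (intro exI[of _ "Poly_Mapping.Abs_poly_mapping ?f"]) (simp add: supported_iff)
qed

section \<open>The ideal generated by an element\<close>

text \<open>
  Let the leading exponent \<open>b\<close> of \<open>E\<close> be smaller than \<open>a\<close>, first differing from it at \<open>k\<close>. Bracketing \<open>D\<close>
  with \<open>x\<^sup>d \<partial>\<^sub>k\<close>, where \<open>d\<close> is the part of \<open>b\<close> below \<open>k\<close>, gives an element of the ideal whose leading
  exponent is smaller than \<open>a\<close> and pointwise at least \<open>b\<close>, so well-founded induction applies. If the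
  leading exponents agree, a scalar multiple of \<open>D\<close> is subtracted first.
\<close>

lemma ideal_fills_block:
  assumes I: "tri_ideal I" and tail: "tail (Suc i) \<subseteq> I"
  shows "has_lead D i a \<Longrightarrow> D \<in> I \<Longrightarrow> E \<in> tail i \<Longrightarrow>
    \<forall>b\<in>Poly_Mapping.keys (E (var i)). b \<preceq> a \<Longrightarrow> E \<in> I"
proof (induction a arbitrary: D E rule: wfp_induct_rule[OF wfP_mon_less])
  case (1 a)
  note IH = 1(1) and lead = 1(2) and DI = 1(3)
  have strict: "E \<in> I" if E: "E \<in> tail i" and below: "\<forall>b\<in>Poly_Mapping.keys (E (var i)). b \<prec> a" for E
  proof (cases "E (var i) = 0")
    case True
    then show ?thesis using tail_Suc[OF E] tail by blast
  next
    case False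
    then obtain b where b: "has_lead E i b" using tail_lead_exists[OF E] by blast
    then have "b \<prec> a" using below by (simp add: has_lead_def)
    then obtain k where k: "lk b k < lk a k" "\<forall>l>k. lk b l = lk a l" by (auto simp: colex_def)
    obtain d where d: "supported k d" "\<forall>l<k. lk d l = lk b l"
      using truncated_mon_exists by metis
    let ?a = "d + (a - unit_mon k)"
    let ?B = "bracket (coord_der (Poly_Mapping.single d 1) k) D"
    have "lk a k \<noteq> 0" using k by simp
    then have lead': "has_lead ?B i ?a" using has_lead_bracket[OF lead _ d(1)] by blast
    have dge: "lk d l = 0" if "k \<le> l" for l using d(1) that by (simp add: supported_iff)
    have look: "lk ?a l = lk d l + (lk a l - (1 when k = l))" for l
      by (simp add: lookup_add lookup_minus lookup_single)
    have "?B \<in> I"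
      by (intro tri_ideal_bracket[OF I] coord_der_triang pol_upto_single d(1) DI)
    moreover have "?a \<prec> a" unfolding colex_def
      by (rule exI[of _ k]) (use k(1) dge in \<open>simp add: look\<close>)
    moreover have "b \<preceq> ?a"
    proof (rule mon_le_if_lookup_le)
      fix l show "lk b l \<le> lk ?a l"
        unfolding look using k d(2) by (cases l k rule: linorder_cases) auto
    qed
    then have "\<forall>c\<in>Poly_Mapping.keys (E (var i)). c \<preceq> ?a"
      using b mon_le_trans unfolding has_lead_def by metis
    ultimately show ?thesis using IH[OF _ lead' _ E] by blast
  qed
  let ?p = "D (var i)" and ?q = "E (var i)"
  define c where "c = lk ?q a / lk ?p a"
  define F where "F = (\<lambda>f. E f - const_pol c * D f)"
  have D: "D \<in> tail i" "lk ?p a \<noteq> 0" using lead by (auto simp: has_lead_def in_keys_iff)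
  have F: "F f = E f + const_pol (- c) * D f" for f by (simp add: F_def const_pol_minus)
  have "F \<in> tail i"
  proof (rule tailI)
    show "F \<in> triang" unfolding F[abs_def]
      by (intro add_triang const_mult_triang tail_triang[OF 1(4)] tail_triang[OF D(1)])
    show "F (var j) = 0" if "j < i" for j
      using tail_var[OF D(1) that] tail_var[OF 1(4) that] by (simp add: F_def)
  qed
  moreover have "b \<prec> a" if b: "b \<in> Poly_Mapping.keys (F (var i))" for b
  proof -
    have nz: "lk ?q b - c * lk ?p b \<noteq> 0"
      using b by (simp add: in_keys_iff F_def lookup_minus lookup_const_pol_mult)
    then have "b \<noteq> a" using D(2) by (auto simp: c_def)
    moreover have "b \<in> Poly_Mapping.keys ?q \<or> b \<in> Poly_Mapping.keys ?p"
      using nz by (auto simp: in_keys_iff)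
    then have "b \<preceq> a" using 1(5) lead unfolding has_lead_def by blast
    ultimately show ?thesis by blast
  qed
  ultimately have "F \<in> I" using strict by blast
  then have "(\<lambda>f. F f + const_pol c * D f) \<in> I"
    by (intro tri_ideal_add[OF I] tri_ideal_const_mult[OF I] DI)
  then show "E \<in> I" by (simp add: F_def)
qed

text \<open>
  Coefficientwise integration with respect to the variable \<open>i\<close>, which is allowed in every
  coefficient of index above \<open>i\<close>.
\<close>

lemma tail_is_bracket:
  assumes F: "F \<in> tail (Suc i)"
  shows "\<exists>E\<in>tail (Suc i). F = bracket (coord_der 1 i) E"
proof -
  have "\<exists>b. b \<in> pol_upto j \<and> pderiv_var i b = F (var j) \<and> (F (var j) = 0 \<longrightarrow> b = 0)" for j
  proof (cases "F (var j) = 0")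
    case False
    then have "i < j" using tail_var[OF F, of j] by (meson not_less_eq)
    then show ?thesis
      using antiderivative[OF triang_coeff[OF tail_triang[OF F]]] False by metis
  qed (rule exI[of _ 0], simp)
  then obtain b where b: "\<And>j. b j \<in> pol_upto j" "\<And>j. pderiv_var i (b j) = F (var j)"
    "\<And>j. F (var j) = 0 \<Longrightarrow> b j = 0" by metis
  obtain N where "\<forall>j\<ge>N. F (var j) = 0" using triang_coeff_vanish[OF tail_triang[OF F]] by metis
  then have "\<And>j. N \<le> j \<Longrightarrow> b j = 0" using b(3) by simp
  then obtain E where E: "E \<in> triang" "\<forall>j. E (var j) = b j"
    using triang_exists[of b N, OF b(1)] by metis
  have "E \<in> tail (Suc i)" by (rule tailI[OF E(1)]) (use E(2) b(3) tail_var[OF F] in simp)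
  moreover have one: "1 \<in> pol_upto i" using pol_upto_const[of 1] by simp
  have "F = bracket (coord_der 1 i) E"
  proof (rule triang_eqI[OF tail_triang[OF F] bracket_triang[OF coord_der_triang[OF one] E(1)]])
    fix j
    have "E (coord_der 1 i (var j)) = 0"
      using triang_const[OF E(1), of 1] triang_0[OF E(1)] by (simp add: coord_der_var)
    then show "F (var j) = bracket (coord_der 1 i) E (var j)"
      using E(2) b(2) by (simp add: coord_der_def)
  qed
  ultimately show ?thesis by blast
qed

lemma ideal_has_constant_lead:
  assumes I: "tri_ideal I"
  shows "D \<in> I \<Longrightarrow> has_lead D i a \<Longrightarrow> \<exists>D'\<in>I. has_lead D' i 0"
proof (induction a arbitrary: D rule: wfp_induct_rule[OF wfP_mon_less])
  case (1 a)
  show ?case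
  proof (cases "a = 0")
    case False
    then obtain k where k: "lk a k \<noteq> 0" by (metis lookup_zero poly_mapping_eqI)
    have s: "supported k 0" by (simp add: supported_iff)
    let ?B = "bracket (coord_der (Poly_Mapping.single 0 1) k) D"
    have "?B \<in> I" by (intro tri_ideal_bracket[OF I] coord_der_triang pol_upto_single s 1(2))
    moreover have "has_lead ?B i (a - unit_mon k)"
      using has_lead_bracket[OF 1(3) k s] by simp
    moreover have "a - unit_mon k \<prec> a" unfolding colex_def
      by (rule exI[of _ k]) (use k in \<open>simp add: lookup_minus lookup_single\<close>)
    ultimately show ?thesis using 1(1) by blast
  qed (use 1 in blast)
qed

lemma constant_lead_coeff:
  assumes "has_lead D i 0"
  obtains c where "c \<noteq> 0" "D (var i) = const_pol c"
proof
  let ?c = "lk (D (var i)) 0"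
  show "?c \<noteq> 0" using assms by (simp add: has_lead_def in_keys_iff)
  show "D (var i) = const_pol ?c"
  proof (rule poly_mapping_eqI)
    fix b
    have "lk (D (var i)) b = 0" if "b \<noteq> 0"
      using assms that not_mon_less_0 unfolding has_lead_def by (metis in_keys_iff)
    then show "lk (D (var i)) b = lk (const_pol ?c) b"
      by (cases "b = 0") (simp_all add: const_pol_def lookup_single_not_eq)
  qed
qed

text \<open>
  The passage from one block to the next: if \<open>D\<close> starts with a constant multiple of \<open>\<partial>\<^sub>i\<close>, then
  \<open>[D, x\<^sub>i\<^sup>n\<^sup>+\<^sup>1 \<partial>\<^sub>i\<^sub>+\<^sub>1]\<close> has leading term a multiple of \<open>x\<^sub>i\<^sup>n \<partial>\<^sub>i\<^sub>+\<^sub>1\<close>.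
\<close>

lemma ideal_next_block_unbounded:
  assumes I: "tri_ideal I" and D: "D \<in> I" and lead: "has_lead D i 0"
  shows "\<exists>E\<in>I. has_lead E (Suc i) (Poly_Mapping.single i n)"
proof -
  let ?s = "Poly_Mapping.single (Poly_Mapping.single i (Suc n)) 1 :: 'a mpol"
  let ?C = "coord_der ?s (Suc i)"
  let ?B = "bracket D ?C"
  have Dt: "D \<in> tail i" "D \<in> triang" using lead by (auto simp: has_lead_def tail_def)
  obtain c where c: "c \<noteq> 0" "D (var i) = const_pol c" by (rule constant_lead_coeff[OF lead])
  have s: "?s \<in> pol_upto (Suc i)"
    by (rule pol_upto_single) (simp add: supported_iff lookup_single)
  have B0: "?B (var l) = (if l = Suc i then D ?s else 0)" if "l \<le> Suc i" for l
  proof -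
    have "pderiv_var (Suc i) (D (var l)) = 0"
      by (rule pderiv_var_eq_0[OF triang_coeff[OF Dt(2)] that])
    then have "?C (D (var l)) = 0" by (simp add: coord_der_def)
    then show ?thesis by (simp add: coord_der_var triang_0[OF Dt(2)])
  qed
  have "D ?s = const_pol c * pderiv_var i ?s" using tail_pol_upto_Suc[OF Dt(1) s] c(2) by simp
  also have "pderiv_var i ?s = Poly_Mapping.single (Poly_Mapping.single i n) (of_nat (Suc n))"
    by (simp add: pderiv_var_single single_diff[symmetric] del: of_nat_Suc)
  finally have Ds: "D ?s = Poly_Mapping.single (Poly_Mapping.single i n) (c * of_nat (Suc n))"
    by (simp add: const_pol_def mult_single del: of_nat_Suc)
  have "?B \<in> tail (Suc i)"
    by (rule tailI[OF bracket_triang[OF Dt(2) coord_der_triang[OF s]]], subst B0) simp_all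
  moreover have "Poly_Mapping.keys (?B (var (Suc i))) = {Poly_Mapping.single i n}"
    using c(1) by (subst B0) (simp_all add: Ds del: of_nat_Suc)
  ultimately have "has_lead ?B (Suc i) (Poly_Mapping.single i n)" unfolding has_lead_def by simp
  moreover have "?B \<in> I" by (rule tri_ideal_bracket'[OF I D coord_der_triang[OF s]])
  ultimately show ?thesis by blast
qed

text \<open>
  For \<open>m\<close> beyond all indices occurring in \<open>D\<close> the bracket \<open>[D, x\<^sub>i \<partial>\<^sub>m]\<close> has no further terms: it is a
  nonzero multiple of \<open>\<partial>\<^sub>m\<close>, whose brackets already exhaust a tail.
\<close>

lemma ideal_contains_far_tail:
  assumes I: "tri_ideal I" and D: "D \<in> I" and lead: "has_lead D i 0"
  shows "\<exists>m>i. tail m \<subseteq> I"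
proof -
  have Dt: "D \<in> tail i" "D \<in> triang" using lead by (auto simp: has_lead_def tail_def)
  obtain c where c: "c \<noteq> 0" "D (var i) = const_pol c" by (rule constant_lead_coeff[OF lead])
  obtain N where N: "\<forall>j\<ge>N. D (var j) = 0" using triang_coeff_vanish[OF Dt(2)] by blast
  \<comment> \<open>large enough that \<open>\<partial>\<^sub>m\<close> kills the coefficients before \<open>m\<close> and those from \<open>m\<close> on vanish\<close>
  define m where "m = max N (Suc i)"
  have m: "i < m" "N \<le> m" by (auto simp: m_def)
  let ?C = "coord_der (var i) m"
  have v: "var i \<in> pol_upto m" by (rule pol_upto_single) (use m in \<open>simp add: supported_iff lookup_single\<close>)
  have one: "1 \<in> pol_upto m" using pol_upto_const[of 1] by simp
  have "?C (D (var l)) = 0" for l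
  proof (cases "l \<le> m")
    case True
    then show ?thesis by (simp add: coord_der_def pderiv_var_eq_0[OF triang_coeff[OF Dt(2)]])
  next
    case False
    then show ?thesis using N m by (simp add: coord_der_def)
  qed
  then have B: "bracket D ?C (var l) = (if l = m then const_pol c else 0)" for l
    using c(2) by (simp add: coord_der_var triang_0[OF Dt(2)])
  have BI: "bracket D ?C \<in> I" by (rule tri_ideal_bracket'[OF I D coord_der_triang[OF v]])
  have cI: "(\<lambda>f. const_pol (1 / c) * bracket D ?C f) \<in> I" by (rule tri_ideal_const_mult[OF I BI])
  have "(\<lambda>f. const_pol (1 / c) * bracket D ?C f) = coord_der 1 m"
  proof (rule triang_eqI[OF _ coord_der_triang[OF one]])
    show "(\<lambda>f. const_pol (1 / c) * bracket D ?C f) \<in> triang"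
      using cI tri_ideal_subset[OF I] by blast
    show "const_pol (1 / c) * bracket D ?C (var l) = coord_der 1 m (var l)" for l
      by (subst B) (use c(1) in \<open>simp add: coord_der_var flip: const_pol_mult\<close>)
  qed
  then have dm: "coord_der 1 m \<in> I" using cI by simp
  have "tail (Suc m) \<subseteq> I"
  proof
    fix F :: "'a mpol \<Rightarrow> 'a mpol" assume "F \<in> tail (Suc m)"
    then obtain E where E: "E \<in> tail (Suc m)" "F = bracket (coord_der 1 m) E"
      using tail_is_bracket by blast
    show "F \<in> I" unfolding E(2) by (rule tri_ideal_bracket'[OF I dm tail_triang[OF E(1)]])
  qed
  then show ?thesis using m(1) by (intro exI[of _ "Suc m"]) simp
qed

text \<open>
  Downward induction from the far tail. In each block between, the ideal contains elements with
  leading exponent \<open>x\<^sub>l\<^sup>n\<close> for every \<open>n\<close>, with \<open>l\<close> the highest variable available there; these exceed any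
  given exponent, so the whole block is filled.
\<close>

lemma ideal_contains_tail:
  assumes I: "tri_ideal I" and D: "D \<in> I" and lead: "has_lead D i a"
  shows "tail (Suc i) \<subseteq> I"
proof -
  obtain D0 where D0: "D0 \<in> I" "has_lead D0 i 0"
    using ideal_has_constant_lead[OF I D lead] by blast
  \<comment> \<open>exponent \<open>n = 0\<close>: constant leading coefficients propagate upwards\<close>
  have const: "\<exists>F\<in>I. has_lead F k 0" if "i \<le> k" for k
    using that
  proof (induction k rule: dec_induct)
    case (step k)
    then obtain F where "F \<in> I" "has_lead F k 0" by blast
    then show ?case using ideal_next_block_unbounded[OF I, of F k 0] by simp
  qed (use D0 in blast)
  obtain m where m: "i < m" "tail m \<subseteq> I" using ideal_contains_far_tail[OF I D0] by blast
  then have "Suc i \<le> m" by simp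
  then show ?thesis using m(2)
  proof (induction rule: inc_induct)
    case (step k)
    then have sub: "tail (Suc k) \<subseteq> I" by blast
    obtain l where k: "k = Suc l" "i \<le> l" using step(1) by (cases k) auto
    show ?case
    proof
      fix E :: "'a mpol \<Rightarrow> 'a mpol" assume E: "E \<in> tail k"
      let ?A = "Poly_Mapping.keys (E (var k))"
      \<comment> \<open>an exponent exceeding every exponent of the variable \<open>l\<close> in the coefficient to be reached\<close>
      define n where "n = Suc (\<Sum>b\<in>?A. lk b l)"
      obtain F0 where "F0 \<in> I" "has_lead F0 l 0" using const[OF k(2)] by blast
      then obtain F where F: "F \<in> I" "has_lead F k (Poly_Mapping.single l n)"
        using ideal_next_block_unbounded[OF I] k(1) by blast
      have "b \<prec> Poly_Mapping.single l n" if b: "b \<in> ?A" for b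
      proof -
        have "lk b l < n" unfolding n_def using b member_le_sum[of b ?A "\<lambda>b. lk b l"]
          by (simp add: less_Suc_eq_le)
        moreover have "supported k b"
          using b triang_coeff[OF tail_triang[OF E], of k] by (simp add: pol_upto_iff)
        ultimately show ?thesis unfolding colex_def supported_iff k(1)
          by (intro exI[of _ l]) (simp add: lookup_single)
      qed
      then show "E \<in> I" by (intro ideal_fills_block[OF I sub F(2,1) E] ballI disjI2)
    qed
  qed
qed

text \<open>
  The central fact: membership in an ideal depends on the leading term only, and monotonically.
\<close>

lemma ideal_downward_closed:
  assumes I: "tri_ideal I" and D: "D \<in> I" "has_lead D i a"
    and E: "has_lead E j b" and le: "i < j \<or> i = j \<and> b \<preceq> a"
  shows "E \<in> I"
  using le
proof
  assume "i < j"
  then have "E \<in> tail (Suc i)" using E tail_antimono[of "Suc i" j] unfolding has_lead_def by auto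
  then show ?thesis using ideal_contains_tail[OF I D] by blast
next
  assume ij: "i = j \<and> b \<preceq> a"
  then have "E \<in> tail i" "\<forall>c\<in>Poly_Mapping.keys (E (var i)). c \<preceq> a"
    using E mon_le_trans[of _ b a] unfolding has_lead_def by auto
  then show ?thesis using ideal_fills_block[OF I ideal_contains_tail[OF I D] D(2,1)] by blast
qed

lemma tri_ideals_comparable:
  assumes I: "tri_ideal I" and J: "tri_ideal J"
  shows "I \<subseteq> J \<or> J \<subseteq> I"
proof (rule disjCI)
  assume "\<not> J \<subseteq> I"
  then obtain D where D: "D \<in> J" "D \<notin> I" by blast
  then have "D \<in> triang" "D \<noteq> (\<lambda>f. 0)" using tri_ideal_subset[OF J] tri_ideal_zero[OF I] by auto
  then obtain i a where lead: "has_lead D i a" using has_lead_exists by blast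
  show "I \<subseteq> J"
  proof
    fix E assume E: "E \<in> I"
    show "E \<in> J"
    proof (cases "E = (\<lambda>f. 0)")
      case True
      then show ?thesis using tri_ideal_zero[OF J] by simp
    next
      case False
      then obtain j b where lead': "has_lead E j b"
        using has_lead_exists E tri_ideal_subset[OF I] by blast
      have "\<not> (j < i \<or> j = i \<and> a \<preceq> b)" using ideal_downward_closed[OF I E lead' lead] D(2) by blast
      then have "i < j \<or> i = j \<and> b \<preceq> a" using mon_total[of a b] by (metis linorder_neqE_nat)
      then show ?thesis by (rule ideal_downward_closed[OF J D(1) lead lead'])
    qed
  qed
qed

section \<open>Ideals of elements with bounded leading term\<close>

definition lower :: "nat \<Rightarrow> (nat \<Rightarrow>\<^sub>0 nat) \<Rightarrow> ('k::field_char_0 mpol \<Rightarrow> 'k mpol) set" where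
  "lower i a = {D \<in> tail i. \<forall>b\<in>Poly_Mapping.keys (D (var i)). b \<prec> a}"

text \<open>
  Triangularity: \<open>\<partial>\<^sub>j\<close> lowers the exponent of the variable \<open>j\<close>, and its coefficient involves only
  smaller, less significant variables.
\<close>

lemma keys_triang_less:
  assumes E: "E \<in> triang" and m: "m \<in> Poly_Mapping.keys (E p)"
  shows "\<exists>b\<in>Poly_Mapping.keys p. m \<prec> b"
proof -
  obtain n where n: "\<forall>f. E f = (\<Sum>i<n. E (var i) * pderiv_var i f)"
    using triang_finite_expansion[OF E] by (elim exE)
  have "m \<in> Poly_Mapping.keys (\<Sum>i<n. E (var i) * pderiv_var i p)"
    using m by (subst (asm) n[rule_format])
  then obtain j where "m \<in> Poly_Mapping.keys (E (var j) * pderiv_var j p)"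
    using keys_sum[of "\<lambda>i. E (var i) * pderiv_var i p" "{..<n}"] by blast
  then obtain c b where cb: "c \<in> Poly_Mapping.keys (E (var j))"
    "b \<in> Poly_Mapping.keys (pderiv_var j p)" "m = c + b"
    using keys_mult[of "E (var j)" "pderiv_var j p"] by blast
  have "supported j c" using cb(1) triang_coeff[OF E, of j] by (simp add: pol_upto_iff)
  then have "m \<prec> b + unit_mon j" unfolding cb(3) colex_def supported_iff
    by (intro exI[of _ j]) (simp add: lookup_add lookup_single)
  moreover have "b + unit_mon j \<in> Poly_Mapping.keys p" using cb(2) by (simp add: keys_pderiv_var)
  ultimately show ?thesis by blast
qed

text \<open>
  Up to index \<open>i\<close> a bracket with \<open>D \<in> lower i a\<close> only sees the other factor acting on the
  coefficients of \<open>D\<close>: the coefficients that \<open>D\<close> would act on involve no variable of index at least \<open>i\<close>.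
\<close>

lemma tri_ideal_lower: "tri_ideal (lower i a)"
  unfolding tri_ideal_iff
proof (intro conjI ballI allI)
  show "lower i a \<subseteq> triang" by (auto simp: lower_def tail_def)
  show "(\<lambda>f. 0) \<in> lower i a" by (simp add: lower_def tail_def zero_triang)
  show "(\<lambda>f. D f + E f) \<in> lower i a" if "D \<in> lower i a" "E \<in> lower i a" for D E :: "'a mpol \<Rightarrow> 'a mpol"
    using that keys_add[of "D (var i)" "E (var i)"] by (auto simp: lower_def tail_def add_triang)
  show "(\<lambda>f. const_pol c * D f) \<in> lower i a" if "D \<in> lower i a" for c and D :: "'a mpol \<Rightarrow> 'a mpol"
    using that by (auto simp: lower_def tail_def const_mult_triang in_keys_iff lookup_const_pol_mult)
next
  fix E D :: "'a mpol \<Rightarrow> 'a mpol" assume E: "E \<in> triang" and "D \<in> lower i a"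
  then have D: "D \<in> tail i" "\<And>b. b \<in> Poly_Mapping.keys (D (var i)) \<Longrightarrow> b \<prec> a"
    by (auto simp: lower_def)
  have "D (E (var l)) = 0" if "l \<le> i" for l
    by (rule tail_pol_upto[OF D(1) pol_upto_mono[OF triang_coeff[OF E] that]])
  then have B: "bracket E D (var l) = E (D (var l))" if "l \<le> i" for l using that by simp
  have "bracket E D \<in> tail i"
    by (rule tailI[OF bracket_triang[OF E tail_triang[OF D(1)]]], subst B)
       (simp_all add: tail_var[OF D(1)] triang_0[OF E])
  moreover have "m \<prec> a" if m: "m \<in> Poly_Mapping.keys (bracket E D (var i))" for m
  proof -
    have "m \<in> Poly_Mapping.keys (E (D (var i)))" using m B[of i] by simp
    then obtain b where "b \<in> Poly_Mapping.keys (D (var i))" "m \<prec> b"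
      using keys_triang_less[OF E] by blast
    then show ?thesis using D(2) colex_trans by blast
  qed
  ultimately show "bracket E D \<in> lower i a" by (simp add: lower_def)
qed

lemma lower_0: "lower i 0 = tail (Suc i)"
proof (intro subset_antisym subsetI)
  fix D :: "'a mpol \<Rightarrow> 'a mpol" assume D: "D \<in> lower i 0"
  then have "Poly_Mapping.keys (D (var i)) = {}" using not_mon_less_0 by (auto simp: lower_def)
  then show "D \<in> tail (Suc i)" using D by (simp add: lower_def tail_Suc)
next
  fix D :: "'a mpol \<Rightarrow> 'a mpol" assume D: "D \<in> tail (Suc i)"
  then show "D \<in> lower i 0" by (simp add: lower_def tail_def)
qed

lemma tri_ideal_tail: "tri_ideal (tail (Suc i))"
  using tri_ideal_lower[of i 0] unfolding lower_0 .

lemma coord_der_lower_iff: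
  assumes "supported i a"
  shows "coord_der (Poly_Mapping.single a (1 :: 'k::field_char_0)) i \<in> lower i b \<longleftrightarrow> a \<prec> b"
  using coord_der_triang[OF pol_upto_single[OF assms], of "1 :: 'k"]
  by (simp add: lower_def tail_def coord_der_var)

lemma lower_strict_mono:
  assumes "a \<prec> b" "supported i a"
  shows "lower i a \<subset> (lower i b :: ('k::field_char_0 mpol \<Rightarrow> 'k mpol) set)"
proof
  show "lower i a \<subseteq> (lower i b :: ('k mpol \<Rightarrow> 'k mpol) set)"
    using assms(1) colex_trans by (auto simp: lower_def)
  show "lower i a \<noteq> (lower i b :: ('k mpol \<Rightarrow> 'k mpol) set)"
    using coord_der_lower_iff[OF assms(2), of a, where ?'k = 'k]
      coord_der_lower_iff[OF assms(2), of b, where ?'k = 'k] assms(1) by auto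
qed

lemma coord_der_tail: "coord_der (1 :: 'k::field_char_0 mpol) i \<in> tail i"
    "coord_der (1 :: 'k::field_char_0 mpol) i \<notin> tail (Suc i)"
proof -
  have "(1 :: 'k mpol) \<in> pol_upto i" using pol_upto_const[of "1 :: 'k"] by simp
  then have "coord_der (1 :: 'k mpol) i \<in> triang" by (rule coord_der_triang)
  then show "coord_der (1 :: 'k mpol) i \<in> tail i" "coord_der (1 :: 'k mpol) i \<notin> tail (Suc i)"
    by (auto simp: tail_def coord_der_var)
qed

lemma u_infinity_not_artinian:
  "\<not> lie_artinian ring_of_type_algebra (u_infinity :: ('k::field_char_0, _) module)"
proof
  let ?I = "\<lambda>n. tail (Suc n) :: ('k mpol \<Rightarrow> 'k mpol) set"
  assume art: "lie_artinian ring_of_type_algebra (u_infinity :: ('k::field_char_0, _) module)"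
  have "(\<forall>n. tri_ideal (?I n)) \<and> (\<forall>n. ?I (Suc n) \<subseteq> ?I n)"
    by (simp add: tri_ideal_tail tail_antimono)
  then have "\<exists>N. \<forall>n\<ge>N. ?I n = ?I N" by (rule art[unfolded lie_artinian_def, THEN spec[of _ ?I], THEN mp])
  then obtain N where N: "\<forall>n\<ge>N. ?I n = ?I N" ..
  have "?I (Suc N) = ?I N" by (rule N[rule_format]) simp
  then show False using coord_der_tail[of "Suc N", where ?'k = 'k] by simp
qed

lemma u_infinity_not_noetherian:
  "\<not> lie_noetherian ring_of_type_algebra (u_infinity :: ('k::field_char_0, _) module)"
proof
  let ?I = "\<lambda>n. lower 1 (Poly_Mapping.single 0 n) :: ('k mpol \<Rightarrow> 'k mpol) set"
  assume noeth: "lie_noetherian ring_of_type_algebra (u_infinity :: ('k::field_char_0, _) module)"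
  have strict: "?I n \<subset> ?I (Suc n)" for n
    by (rule lower_strict_mono) (auto simp: colex_def lookup_single supported_iff intro!: exI[of _ 0])
  then have "(\<forall>n. tri_ideal (?I n)) \<and> (\<forall>n. ?I n \<subseteq> ?I (Suc n))"
    by (simp add: tri_ideal_lower psubset_imp_subset)
  then have "\<exists>N. \<forall>n\<ge>N. ?I n = ?I N" by (rule noeth[unfolded lie_noetherian_def, THEN spec[of _ ?I], THEN mp])
  then obtain N where N: "\<forall>n\<ge>N. ?I n = ?I N" ..
  have "?I (Suc N) = ?I N" by (rule N[rule_format]) simp
  then show False using strict[of N] by simp
qed

section \<open>Ranking the ideals that contain a tail\<close>

text \<open>
  For fixed \<open>m\<close> the leading terms with \<open>i \<le> m\<close> are well-ordered. They are encoded in \<open>\<omega>\<^sup>\<omega>\<close> by storing the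
  block in position \<open>m\<close>, reversed so that smaller \<open>i\<close> counts as larger; the exponent vector occupies
  the positions below \<open>i\<close>. The stored number is at least \<open>1\<close>, which keeps the zero function free for
  the zero ideal.
\<close>

definition lead_code :: "nat \<Rightarrow> nat \<Rightarrow> (nat \<Rightarrow>\<^sub>0 nat) \<Rightarrow> nat \<Rightarrow> nat" where
  "lead_code m i a = (lk a)(m := Suc m - i)"

text \<open>
  The codes of the elements outside \<open>I\<close>, with a value above all codes so that the least
  element exists also for the whole algebra.
\<close>

definition outside_codes :: "nat \<Rightarrow> ('k::field_char_0 mpol \<Rightarrow> 'k mpol) set \<Rightarrow> (nat \<Rightarrow> nat) set" where
  "outside_codes m I = insert ((\<lambda>_. 0)(m := m + 2))
    {lead_code m i a | i a. i \<le> m \<and> (\<exists>D\<in>triang - I. has_lead D i a)}"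

definition ideal_rank :: "nat \<Rightarrow> ('k::field_char_0 mpol \<Rightarrow> 'k mpol) set \<Rightarrow> nat \<Rightarrow> nat" where
  "ideal_rank m I = (SOME f. f \<in> outside_codes m I \<and> (\<forall>g\<in>outside_codes m I. f = g \<or> colex f g))"

lemma finsupp_upd: "f \<in> finsupp \<Longrightarrow> f(m := v) \<in> finsupp"
  unfolding finsupp_def mem_Collect_eq
  by (rule finite_subset[of _ "insert m {x. f x \<noteq> 0}"]) auto

lemma zero_finsupp: "(\<lambda>_. 0) \<in> finsupp"
  by (simp add: finsupp_def)

lemma outside_codes_finsupp: "outside_codes m I \<subseteq> finsupp"
  by (auto simp: outside_codes_def lead_code_def intro!: finsupp_upd zero_finsupp)

lemma ideal_rank_least: "ideal_rank m I \<in> outside_codes m I \<and> (\<forall>g\<in>outside_codes m I. ideal_rank m I = g \<or> colex (ideal_rank m I) g)"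
proof -
  have "outside_codes m I \<noteq> {}" by (simp add: outside_codes_def)
  then have "\<exists>f. f \<in> outside_codes m I \<and> (\<forall>g\<in>outside_codes m I. f = g \<or> colex f g)"
    using colex_least[OF outside_codes_finsupp] by (simp add: Bex_def)
  then show ?thesis unfolding ideal_rank_def by (rule someI_ex)
qed

lemma ideal_rank_finsupp: "ideal_rank m I \<in> finsupp"
  using ideal_rank_least outside_codes_finsupp by (meson subsetD)

lemma ideal_rank_nonzero: "ideal_rank m I m \<noteq> 0"
proof -
  have "ideal_rank m I \<in> outside_codes m I" using ideal_rank_least by blast
  then show ?thesis by (auto simp: outside_codes_def lead_code_def)
qed

lemma lead_code_le_imp:
  assumes i: "i \<le> m" "supported i a" and j: "j \<le> m" "supported j b"
    and le: "lead_code m j b = lead_code m i a \<or> colex (lead_code m j b) (lead_code m i a)"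
  shows "i < j \<or> i = j \<and> b \<preceq> a"
proof -
  have a0: "lk a l = 0" "lk b l = 0" if "m \<le> l" for l
    using i j that by (auto simp: supported_iff)
  from le show ?thesis
  proof
    assume eq: "lead_code m j b = lead_code m i a"
    have "Suc m - j = Suc m - i" using fun_cong[OF eq, of m] by (simp add: lead_code_def)
    then have "i = j" using i(1) j(1) by linarith
    moreover have "lk b l = lk a l" for l
      using fun_cong[OF eq, of l] a0[of l] by (cases "l = m") (simp_all add: lead_code_def)
    then have "b = a" by (rule poly_mapping_eqI)
    ultimately show ?thesis by simp
  next
    assume "colex (lead_code m j b) (lead_code m i a)"
    then obtain k where k: "lead_code m j b k < lead_code m i a k" "\<forall>l>k. lead_code m j b l = lead_code m i a l"
      by (auto simp: colex_def)
    consider "k = m" | "k < m" | "m < k" by linarith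
    then show ?thesis
    proof cases
      case 1
      then show ?thesis using k(1) i j by (simp add: lead_code_def) linarith
    next
      case 2
      then have "lead_code m j b m = lead_code m i a m" using k(2) by blast
      then have "i = j" using i(1) j(1) by (simp add: lead_code_def)
      moreover have "lk b l = lk a l" if "k < l" for l
        using k(2)[rule_format, OF that] a0[of l] by (cases "l = m") (simp_all add: lead_code_def)
      then have "b \<prec> a" using k(1) 2 unfolding colex_def by (intro exI[of _ k]) (simp add: lead_code_def)
      ultimately show ?thesis by simp
    next
      case 3
      then show ?thesis using k(1) a0[of k] by (simp add: lead_code_def)
    qed
  qed
qed

lemma lead_code_less_top:
  assumes "i \<le> m" "supported i a"
  shows "colex (lead_code m i a) ((\<lambda>_. 0)(m := m + 2))"
  unfolding colex_def using assms by (intro exI[of _ m]) (simp add: lead_code_def supported_iff)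

text \<open>
  Let \<open>D\<close> be an element outside \<open>I\<close> with the least possible leading term. It lies in \<open>J\<close>, because its
  leading term is at most that of any element of \<open>J\<close> outside \<open>I\<close>. Every element outside \<open>J\<close> then has a
  larger leading term than \<open>D\<close>.
\<close>

lemma ideal_rank_strict_mono:
  fixes I J :: "('k::field_char_0 mpol \<Rightarrow> 'k mpol) set"
  assumes I: "tri_ideal I" and J: "tri_ideal J" and tail: "tail (Suc m) \<subseteq> I" and sub: "I \<subset> J"
  shows "colex (ideal_rank m I) (ideal_rank m J)"
proof -
  let ?top = "(\<lambda>_. 0)(m := m + 2) :: nat \<Rightarrow> nat"
  have notin: "i \<le> m" if "has_lead D i a" "D \<notin> I" for D i a
  proof (rule ccontr)
    assume "\<not> i \<le> m"
    then have "tail i \<subseteq> tail (Suc m)" by (intro tail_antimono) simp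
    then show False using that tail unfolding has_lead_def by blast
  qed
  obtain F where F: "F \<in> J" "F \<notin> I" using sub by blast
  have "F \<in> triang" "F \<noteq> (\<lambda>f. 0)" using F tri_ideal_subset[OF J] tri_ideal_zero[OF I] by auto
  then obtain i a where lF: "has_lead F i a" using has_lead_exists by metis
  have im: "i \<le> m" by (rule notin[OF lF F(2)])
  have "lead_code m i a \<in> outside_codes m I" unfolding outside_codes_def
    using F(2) \<open>F \<in> triang\<close> lF im by blast
  then have leF: "ideal_rank m I = lead_code m i a \<or> colex (ideal_rank m I) (lead_code m i a)" using ideal_rank_least by blast
  then have ltop: "colex (ideal_rank m I) ?top"
    using lead_code_less_top[OF im has_lead_supported[OF lF]] colex_trans by metis
  then have "ideal_rank m I \<noteq> ?top" using colex_irrefl by metis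
  then obtain j b D where D: "ideal_rank m I = lead_code m j b" "j \<le> m" "D \<in> triang - I" "has_lead D j b"
    using ideal_rank_least[of m I] unfolding outside_codes_def by blast
  have "i < j \<or> i = j \<and> b \<preceq> a"
    by (rule lead_code_le_imp[OF im has_lead_supported[OF lF] D(2) has_lead_supported[OF D(4)]])
       (use leF D(1) in simp)
  then have DJ: "D \<in> J" by (rule ideal_downward_closed[OF J F(1) lF D(4)])
  consider "ideal_rank m J = ?top" | k c E where "ideal_rank m J = lead_code m k c" "k \<le> m" "E \<in> triang - J" "has_lead E k c"
    using ideal_rank_least[of m J] unfolding outside_codes_def by blast
  then show ?thesis
  proof cases
    case 1
    then show ?thesis using ltop by simp
  next
    case (2 k c E)
    have "\<not> (lead_code m k c = lead_code m j b \<or> colex (lead_code m k c) (lead_code m j b))"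
    proof
      assume "lead_code m k c = lead_code m j b \<or> colex (lead_code m k c) (lead_code m j b)"
      then have "j < k \<or> j = k \<and> c \<preceq> b"
        by (rule lead_code_le_imp[OF D(2) has_lead_supported[OF D(4)] 2(2) has_lead_supported[OF 2(4)]])
      then have "E \<in> J" by (rule ideal_downward_closed[OF J DJ D(4) 2(4)])
      then show False using 2(3) by blast
    qed
    then show ?thesis
      using colex_total[OF ideal_rank_finsupp[of m I] ideal_rank_finsupp[of m J]] D(1) 2(1) by metis
  qed
qed

lemma nonzero_ideal_contains_tail:
  assumes I: "tri_ideal I" and nz: "I \<noteq> {\<lambda>f. 0}"
  shows "\<exists>m. tail (Suc m) \<subseteq> I"
proof -
  obtain D where D: "D \<in> I" "D \<noteq> (\<lambda>f. 0)" using nz tri_ideal_zero[OF I] by auto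
  then obtain i a where "has_lead D i a" using has_lead_exists tri_ideal_subset[OF I] by blast
  then show ?thesis using ideal_contains_tail[OF I D(1)] by blast
qed

lemma descending_chain_stabilizes:
  assumes I: "\<And>n::nat. tri_ideal (I n)" and desc: "\<And>n. I (Suc n) \<subseteq> I n"
    and tail: "\<And>n. tail (Suc m) \<subseteq> I n"
  shows "\<exists>N. \<forall>n\<ge>N. I n = I N"
proof -
  let ?A = "range (\<lambda>n. ideal_rank m (I n))"
  have "?A \<subseteq> finsupp" using ideal_rank_finsupp by blast
  then obtain f where f: "f \<in> ?A" "\<forall>g\<in>?A. f = g \<or> colex f g" using colex_least[of ?A] by blast
  then obtain N where N: "f = ideal_rank m (I N)" by blast
  have "I n = I N" if "N \<le> n" for n
  proof (rule ccontr)
    assume ne: "I n \<noteq> I N"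
    have "I n \<subseteq> I N" by (rule lift_Suc_antimono_le[of I, OF desc that])
    then have "colex (ideal_rank m (I n)) (ideal_rank m (I N))"
      using ne by (intro ideal_rank_strict_mono I tail) blast
    moreover have "ideal_rank m (I N) = ideal_rank m (I n) \<or> colex (ideal_rank m (I N)) (ideal_rank m (I n))"
      using f(2) unfolding N by blast
    ultimately show False using colex_asym colex_irrefl by metis
  qed
  then show ?thesis by blast
qed

section \<open>Ideals of a Lie quotient\<close>

text \<open>
  \<open>lie_ideal\<close> and \<open>lie_quotient\<close> are defined for unextended records only, while the locale
  \<open>lie_algebra\<close> is generic in the record extension.
\<close>

locale plain_lie_algebra = lie_algebra K L
  for K :: "'k ring" (structure) and L :: "('k, 'v) module" (structure)
begin

lemma bracket_antisym:
  assumes "x \<in> carrier L" "y \<in> carrier L"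
  shows "x \<otimes>\<^bsub>L\<^esub> y = \<ominus>\<^bsub>L\<^esub> (y \<otimes>\<^bsub>L\<^esub> x)"
proof -
  have c: "x \<otimes>\<^bsub>L\<^esub> y \<in> carrier L" "y \<otimes>\<^bsub>L\<^esub> x \<in> carrier L" using assms bracket_closed by auto
  have "\<zero>\<^bsub>L\<^esub> = (x \<oplus>\<^bsub>L\<^esub> y) \<otimes>\<^bsub>L\<^esub> (x \<oplus>\<^bsub>L\<^esub> y)" using assms by (simp add: bracket_alternating)
  also have "\<dots> = (x \<otimes>\<^bsub>L\<^esub> x \<oplus>\<^bsub>L\<^esub> y \<otimes>\<^bsub>L\<^esub> x) \<oplus>\<^bsub>L\<^esub> (x \<otimes>\<^bsub>L\<^esub> y \<oplus>\<^bsub>L\<^esub> y \<otimes>\<^bsub>L\<^esub> y)"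
    using assms by (simp add: bracket_add_left bracket_add_right)
  also have "\<dots> = x \<otimes>\<^bsub>L\<^esub> y \<oplus>\<^bsub>L\<^esub> y \<otimes>\<^bsub>L\<^esub> x"
    using assms c by (simp add: bracket_alternating M.a_comm)
  finally show ?thesis using c by (metis M.minus_equality)
qed

lemma lie_ideal_bracket_right:
  assumes I: "lie_ideal K L I" and "x \<in> I" "y \<in> carrier L"
  shows "x \<otimes>\<^bsub>L\<^esub> y \<in> I"
proof -
  have sub: "submodule I K L" using I by (simp add: lie_ideal_def)
  have "x \<in> carrier L" using submoduleE(1)[OF sub] assms(2) by blast
  moreover have "y \<otimes>\<^bsub>L\<^esub> x \<in> I" using assms by (simp add: lie_ideal_def)
  ultimately show ?thesis using bracket_antisym[of x y] assms(3) submoduleE(3)[OF sub] by simp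
qed

lemma lie_quotient_simps:
  "carrier (lie_quotient L I) = a_rcosets\<^bsub>L\<^esub> I"
  "A \<oplus>\<^bsub>lie_quotient L I\<^esub> B = A <+>\<^bsub>L\<^esub> B"
  "\<zero>\<^bsub>lie_quotient L I\<^esub> = I"
  "A \<otimes>\<^bsub>lie_quotient L I\<^esub> B = rcoset_mult L I A B"
  "c \<odot>\<^bsub>lie_quotient L I\<^esub> A = (\<Union>x\<in>A. I +>\<^bsub>L\<^esub> (c \<odot>\<^bsub>L\<^esub> x))"
  by (simp_all add: lie_quotient_def FactRing_def ring.defs module.defs)

lemma
  assumes I: "lie_ideal K L I" and x: "x \<in> carrier L"
  shows coset_add: "y \<in> carrier L \<Longrightarrow> (I +>\<^bsub>L\<^esub> x) <+>\<^bsub>L\<^esub> (I +>\<^bsub>L\<^esub> y) = I +>\<^bsub>L\<^esub> (x \<oplus>\<^bsub>L\<^esub> y)"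
    and coset_bracket: "y \<in> carrier L \<Longrightarrow>
      rcoset_mult L I (I +>\<^bsub>L\<^esub> x) (I +>\<^bsub>L\<^esub> y) = I +>\<^bsub>L\<^esub> (x \<otimes>\<^bsub>L\<^esub> y)"
    and coset_smult: "c \<in> carrier K \<Longrightarrow>
      (\<Union>z\<in>I +>\<^bsub>L\<^esub> x. I +>\<^bsub>L\<^esub> (c \<odot>\<^bsub>L\<^esub> z)) = I +>\<^bsub>L\<^esub> (c \<odot>\<^bsub>L\<^esub> x)"
    and coset_self: "x \<in> I \<Longrightarrow> I +>\<^bsub>L\<^esub> x = I"
proof -
  have sub: "submodule I K L" using I by (simp add: lie_ideal_def)
  have sg: "subgroup I (add_monoid L)" by (rule submodule.axioms(1)[OF sub])
  interpret A: abelian_subgroup I L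
    by (rule abelian_subgroupI3[OF additive_subgroupI[OF sg] M.abelian_group_axioms])
  note IL = subsetD[OF submoduleE(1)[OF sub]]
  have coset: "\<exists>h\<in>I. z = h \<oplus>\<^bsub>L\<^esub> u" if "z \<in> I +>\<^bsub>L\<^esub> u" for z u
    using that by (auto simp: a_r_coset_def')
  have in_coset: "h \<oplus>\<^bsub>L\<^esub> u \<in> I +>\<^bsub>L\<^esub> u" if "h \<in> I" for h u
    using that by (auto simp: a_r_coset_def')
  have eq: "I +>\<^bsub>L\<^esub> z = I +>\<^bsub>L\<^esub> u" if "z \<in> I +>\<^bsub>L\<^esub> u" "u \<in> carrier L" for z u
    using a_repr_independence[OF that sg] by simp
  show "(I +>\<^bsub>L\<^esub> x) <+>\<^bsub>L\<^esub> (I +>\<^bsub>L\<^esub> y) = I +>\<^bsub>L\<^esub> (x \<oplus>\<^bsub>L\<^esub> y)" if "y \<in> carrier L"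
    by (rule A.a_rcos_sum[OF x that])
  show "I +>\<^bsub>L\<^esub> x = I" if "x \<in> I" by (rule a_coset_join2[OF x sg that])
  show "rcoset_mult L I (I +>\<^bsub>L\<^esub> x) (I +>\<^bsub>L\<^esub> y) = I +>\<^bsub>L\<^esub> (x \<otimes>\<^bsub>L\<^esub> y)" if y: "y \<in> carrier L"
  proof -
    have xy: "x \<otimes>\<^bsub>L\<^esub> y \<in> carrier L" by (rule bracket_closed[OF x y])
    have "I +>\<^bsub>L\<^esub> (a \<otimes>\<^bsub>L\<^esub> b) = I +>\<^bsub>L\<^esub> (x \<otimes>\<^bsub>L\<^esub> y)" if ab: "a \<in> I +>\<^bsub>L\<^esub> x" "b \<in> I +>\<^bsub>L\<^esub> y" for a b
    proof -
      obtain h where h: "h \<in> I" "a = h \<oplus>\<^bsub>L\<^esub> x" using coset[OF ab(1)] by blast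
      obtain g where g: "g \<in> I" "b = g \<oplus>\<^bsub>L\<^esub> y" using coset[OF ab(2)] by blast
      have c: "h \<in> carrier L" "g \<in> carrier L" "b \<in> carrier L"
        using IL h(1) g y by auto
      have "a \<otimes>\<^bsub>L\<^esub> b = h \<otimes>\<^bsub>L\<^esub> b \<oplus>\<^bsub>L\<^esub> (x \<otimes>\<^bsub>L\<^esub> g \<oplus>\<^bsub>L\<^esub> x \<otimes>\<^bsub>L\<^esub> y)"
        using bracket_add_left[OF c(1) x c(3)] bracket_add_right[OF x c(2) y] h(2) g(2) by simp
      also have "\<dots> = (h \<otimes>\<^bsub>L\<^esub> b \<oplus>\<^bsub>L\<^esub> x \<otimes>\<^bsub>L\<^esub> g) \<oplus>\<^bsub>L\<^esub> x \<otimes>\<^bsub>L\<^esub> y"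
        using c x y by (simp add: M.a_assoc bracket_closed)
      finally have "a \<otimes>\<^bsub>L\<^esub> b = (h \<otimes>\<^bsub>L\<^esub> b \<oplus>\<^bsub>L\<^esub> x \<otimes>\<^bsub>L\<^esub> g) \<oplus>\<^bsub>L\<^esub> x \<otimes>\<^bsub>L\<^esub> y" .
      moreover have "h \<otimes>\<^bsub>L\<^esub> b \<oplus>\<^bsub>L\<^esub> x \<otimes>\<^bsub>L\<^esub> g \<in> I"
        using lie_ideal_bracket_right[OF I h(1) c(3)] I x g(1) by (intro submoduleE(5)[OF sub]) (simp_all add: lie_ideal_def)
      ultimately have "a \<otimes>\<^bsub>L\<^esub> b \<in> I +>\<^bsub>L\<^esub> (x \<otimes>\<^bsub>L\<^esub> y)" using in_coset by simp
      then show ?thesis using eq xy by blast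
    qed
    moreover have "x \<in> I +>\<^bsub>L\<^esub> x" "y \<in> I +>\<^bsub>L\<^esub> y" using x y by (auto intro: A.a_rcos_self)
    ultimately show ?thesis unfolding rcoset_mult_def by blast
  qed
  show "(\<Union>z\<in>I +>\<^bsub>L\<^esub> x. I +>\<^bsub>L\<^esub> (c \<odot>\<^bsub>L\<^esub> z)) = I +>\<^bsub>L\<^esub> (c \<odot>\<^bsub>L\<^esub> x)" if c: "c \<in> carrier K"
  proof -
    have "I +>\<^bsub>L\<^esub> (c \<odot>\<^bsub>L\<^esub> z) = I +>\<^bsub>L\<^esub> (c \<odot>\<^bsub>L\<^esub> x)" if z: "z \<in> I +>\<^bsub>L\<^esub> x" for z
    proof -
      obtain h where h: "h \<in> I" "z = h \<oplus>\<^bsub>L\<^esub> x" using coset[OF z] by blast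
      then have "c \<odot>\<^bsub>L\<^esub> z = c \<odot>\<^bsub>L\<^esub> h \<oplus>\<^bsub>L\<^esub> c \<odot>\<^bsub>L\<^esub> x" using IL c x by (simp add: smult_r_distr)
      moreover have "c \<odot>\<^bsub>L\<^esub> h \<in> I" by (rule submoduleE(4)[OF sub c h(1)])
      ultimately show ?thesis using in_coset eq c x by simp
    qed
    moreover have "x \<in> I +>\<^bsub>L\<^esub> x" by (rule A.a_rcos_self[OF x])
    ultimately show ?thesis by blast
  qed
qed

lemma quotient_ideal_preimage:
  assumes I: "lie_ideal K L I" and J: "lie_ideal K (lie_quotient L I) J"
  defines "P \<equiv> {x \<in> carrier L. I +>\<^bsub>L\<^esub> x \<in> J}"
  shows "lie_ideal K L P" and "I \<subseteq> P" and "J = (\<lambda>x. I +>\<^bsub>L\<^esub> x) ` P"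
proof -
  have subI: "submodule I K L" using I by (simp add: lie_ideal_def)
  have subJ: "submodule J K (lie_quotient L I)" using J by (simp add: lie_ideal_def)
  note sg = submodule.axioms(1)[OF subJ]
  have J_sub: "J \<subseteq> a_rcosets\<^bsub>L\<^esub> I" using subgroup.subset[OF sg] by (simp add: lie_quotient_simps)
  have J_zero: "I \<in> J" using subgroup.one_closed[OF sg] by (simp add: lie_quotient_simps)
  have J_add: "A <+>\<^bsub>L\<^esub> B \<in> J" if "A \<in> J" "B \<in> J" for A B
    using subgroup.m_closed[OF sg that] by (simp add: lie_quotient_simps)
  have J_smult: "(\<Union>x\<in>A. I +>\<^bsub>L\<^esub> (c \<odot>\<^bsub>L\<^esub> x)) \<in> J" if "c \<in> carrier K" "A \<in> J" for c A
    using submodule.smult_closed[OF subJ that] by (simp add: lie_quotient_simps)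
  have J_bracket: "rcoset_mult L I A B \<in> J" if "A \<in> a_rcosets\<^bsub>L\<^esub> I" "B \<in> J" for A B
    using J that by (simp add: lie_ideal_def lie_quotient_simps)
  have IL: "I \<subseteq> carrier L" by (rule submoduleE(1)[OF subI])
  show IP: "I \<subseteq> P"
    using IL J_zero coset_self[OF I] by (auto simp: P_def)
  have smult: "c \<odot>\<^bsub>L\<^esub> x \<in> P" if "c \<in> carrier K" "x \<in> P" for c x
    using J_smult[OF that(1), of "I +>\<^bsub>L\<^esub> x"] coset_smult[OF I _ that(1)] that by (auto simp: P_def)
  have "submodule P K L"
  proof (rule submoduleI)
    show "P \<subseteq> carrier L" by (auto simp: P_def)
    show "\<zero>\<^bsub>L\<^esub> \<in> P" using IP subgroup.one_closed[OF submodule.axioms(1)[OF subI]] by auto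
    show "\<ominus>\<^bsub>L\<^esub> x \<in> P" if "x \<in> P" for x
    proof -
      have "x \<in> carrier L" using that by (simp add: P_def)
      then have "\<ominus>\<^bsub>L\<^esub> x = (\<ominus> \<one>) \<odot>\<^bsub>L\<^esub> x" using smult_l_minus[of \<one> x] by simp
      then show ?thesis using smult[OF _ that] by simp
    qed
    show "x \<oplus>\<^bsub>L\<^esub> y \<in> P" if "x \<in> P" "y \<in> P" for x y
      using J_add[of "I +>\<^bsub>L\<^esub> x" "I +>\<^bsub>L\<^esub> y"] coset_add[OF I] that by (simp add: P_def)
  qed (rule smult)
  moreover have "x \<otimes>\<^bsub>L\<^esub> y \<in> P" if "x \<in> carrier L" "y \<in> P" for x y
  proof -
    have "I +>\<^bsub>L\<^esub> x \<in> a_rcosets\<^bsub>L\<^esub> I" by (rule a_rcosetsI[OF IL that(1)])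
    then show ?thesis
      using J_bracket[of "I +>\<^bsub>L\<^esub> x" "I +>\<^bsub>L\<^esub> y"] coset_bracket[OF I that(1)] that by (simp add: P_def bracket_closed)
  qed
  ultimately show "lie_ideal K L P" by (simp add: lie_ideal_def)
  show "J = (\<lambda>x. I +>\<^bsub>L\<^esub> x) ` P"
    using J_sub by (auto simp: P_def A_RCOSETS_def')
qed

end

text \<open>
  A descending chain of ideals of the quotient pulls back to one of ideals above \<open>I\<close>, hence above a
  fixed tail.
\<close>

lemma u_infinity_almost_artinian:
  "almost_artinian ring_of_type_algebra (u_infinity :: ('k::field_char_0, _) module)"
  unfolding almost_artinian_def lie_artinian_def
proof (intro allI impI)
  let ?K = "ring_of_type_algebra :: 'k ring"
  let ?G = "u_infinity :: ('k, 'k mpol \<Rightarrow> 'k mpol) module"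
  fix I and J :: "nat \<Rightarrow> ('k mpol \<Rightarrow> 'k mpol) set set"
  assume I: "tri_ideal I" and nz: "I \<noteq> {\<zero>\<^bsub>?G\<^esub>}"
    and J: "(\<forall>n. lie_ideal ?K (lie_quotient ?G I) (J n)) \<and> (\<forall>n. J (Suc n) \<subseteq> J n)"
  define P where "P n = {x \<in> carrier ?G. I +>\<^bsub>?G\<^esub> x \<in> J n}" for n
  have lie: "plain_lie_algebra ?K ?G"
    using lie_algebra_u_infinity by (simp add: plain_lie_algebra_def)
  have Jn: "lie_ideal ?K (lie_quotient ?G I) (J n)" for n using J by blast
  note pre = plain_lie_algebra.quotient_ideal_preimage[OF lie I Jn, folded P_def]
  have JP: "J n = (\<lambda>x. I +>\<^bsub>?G\<^esub> x) ` P n" for n by (rule pre(3))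
  moreover have "tri_ideal (P n)" for n by (rule pre(1))
  moreover have "I \<subseteq> P n" for n by (rule pre(2))
  moreover have "P (Suc n) \<subseteq> P n" for n using J by (auto simp: P_def)
  moreover obtain m where "tail (Suc m) \<subseteq> I"
    using nonzero_ideal_contains_tail[OF I] nz by (auto simp: u_infinity_def)
  ultimately obtain N where N: "\<forall>n\<ge>N. P n = P N"
    using descending_chain_stabilizes[of P m] by (meson subset_trans)
  have "J n = J N" if "N \<le> n" for n
    using N[rule_format, OF that] JP[of n] JP[of N] by simp
  then show "\<exists>N. \<forall>n\<ge>N. J n = J N" by blast
qed

section \<open>Ideals are characteristic\<close>

text \<open>
  The derived algebra of a tail is the next tail, and every element of it is a single bracket. This
  describes the tails in terms of the Lie structure alone, so automorphisms preserve them.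
\<close>

lemma tail_Suc_eq_brackets: "tail (Suc i) = (\<lambda>(D, E). bracket D E) ` (tail i \<times> tail i)"
proof (intro subset_antisym subsetI)
  fix F :: "'a mpol \<Rightarrow> 'a mpol" assume "F \<in> tail (Suc i)"
  then obtain E where E: "E \<in> tail (Suc i)" "F = bracket (coord_der 1 i) E"
    using tail_is_bracket by blast
  moreover have "E \<in> tail i" using E(1) tail_antimono[of i "Suc i"] by auto
  ultimately show "F \<in> (\<lambda>(D, E). bracket D E) ` (tail i \<times> tail i)"
    using coord_der_tail(1) by (intro image_eqI[of _ _ "(coord_der 1 i, E)"]) simp_all
next
  fix F :: "'a mpol \<Rightarrow> 'a mpol" assume "F \<in> (\<lambda>(D, E). bracket D E) ` (tail i \<times> tail i)"
  then obtain D E where F: "F = bracket D E" and D: "D \<in> tail i" and E: "E \<in> tail i" by auto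
  have "D (E (var j)) = 0" "E (D (var j)) = 0" if "j < Suc i" for j
    using that by (intro tail_pol_upto[OF D] tail_pol_upto[OF E] pol_upto_mono[OF triang_coeff]
        tail_triang[OF D] tail_triang[OF E]; simp)+
  then show "F \<in> tail (Suc i)"
    unfolding F by (intro tailI bracket_triang tail_triang[OF D] tail_triang[OF E]) simp
qed

lemma tri_automorphism_iff:
  "lie_automorphism ring_of_type_algebra u_infinity s \<longleftrightarrow>
    bij_betw s triang triang \<and>
    (\<forall>D\<in>triang. \<forall>E\<in>triang. s (\<lambda>f. D f + E f) = (\<lambda>f. s D f + s E f)) \<and>
    (\<forall>c. \<forall>D\<in>triang. s (\<lambda>f. const_pol c * D f) = (\<lambda>f. const_pol c * s D f)) \<and>
    (\<forall>D\<in>triang. \<forall>E\<in>triang. s (bracket D E) = bracket (s D) (s E))"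
  unfolding lie_automorphism_def carrier_u_infinity
  by (simp add: u_infinity_def ring_of_type_algebra_def)

context
  fixes s :: "('k::field_char_0 mpol \<Rightarrow> 'k mpol) \<Rightarrow> ('k mpol \<Rightarrow> 'k mpol)"
  assumes s: "lie_automorphism ring_of_type_algebra u_infinity s"
begin

lemma automorphism_bij: "bij_betw s triang triang"
  and automorphism_add: "D \<in> triang \<Longrightarrow> E \<in> triang \<Longrightarrow> s (\<lambda>f. D f + E f) = (\<lambda>f. s D f + s E f)"
  and automorphism_const_mult: "D \<in> triang \<Longrightarrow> s (\<lambda>f. const_pol c * D f) = (\<lambda>f. const_pol c * s D f)"
  and automorphism_bracket: "D \<in> triang \<Longrightarrow> E \<in> triang \<Longrightarrow> s (bracket D E) = bracket (s D) (s E)"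
  using s unfolding tri_automorphism_iff by auto

lemma automorphism_triang: "D \<in> triang \<Longrightarrow> s D \<in> triang"
  using automorphism_bij bij_betwE by blast

lemma automorphism_tail: "s ` tail i = tail i"
proof (induction i)
  case 0
  have "tail 0 = (triang :: ('k mpol \<Rightarrow> 'k mpol) set)" by (auto simp: tail_def)
  then show ?case using automorphism_bij by (simp add: bij_betw_def)
next
  case (Suc i)
  have "s ` tail (Suc i) = (\<lambda>(D, E). bracket (s D) (s E)) ` (tail i \<times> tail i)"
    unfolding tail_Suc_eq_brackets image_image
    by (rule image_cong[OF refl]) (auto intro!: automorphism_bracket tail_triang)
  also have "\<dots> = (\<lambda>(D, E). bracket D E) ` ((s ` tail i) \<times> (s ` tail i))"
    by (auto simp: image_iff) 
  also have "\<dots> = tail (Suc i)" unfolding Suc tail_Suc_eq_brackets ..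
  finally show ?case .
qed

lemma automorphism_image_ideal:
  assumes I: "tri_ideal I"
  shows "tri_ideal (s ` I)"
  unfolding tri_ideal_iff
proof (intro conjI ballI allI)
  note sub = subsetD[OF tri_ideal_subset[OF I]]
  show "s ` I \<subseteq> triang" using sub automorphism_triang by blast
  show "(\<lambda>f. 0) \<in> s ` I"
    using automorphism_const_mult[OF zero_triang, of 0] tri_ideal_zero[OF I] by (intro image_eqI) auto
  show "(\<lambda>f. D f + E f) \<in> s ` I" if h: "D \<in> s ` I" "E \<in> s ` I" for D E
  proof -
    obtain D' E' where DE: "D = s D'" "D' \<in> I" "E = s E'" "E' \<in> I" using h by auto
    show ?thesis
      unfolding DE(1,3) automorphism_add[OF sub[OF DE(2)] sub[OF DE(4)], symmetric]
      by (rule imageI[OF tri_ideal_add[OF I DE(2,4)]])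
  qed
  show "(\<lambda>f. const_pol c * D f) \<in> s ` I" if h: "D \<in> s ` I" for c D
  proof -
    obtain D' where D: "D = s D'" "D' \<in> I" using h by auto
    show ?thesis
      unfolding D(1) automorphism_const_mult[OF sub[OF D(2)], symmetric]
      by (rule imageI[OF tri_ideal_const_mult[OF I D(2)]])
  qed
  show "bracket D E \<in> s ` I" if h: "D \<in> triang" "E \<in> s ` I" for D E
  proof -
    have "D \<in> s ` triang" using automorphism_bij h(1) by (simp add: bij_betw_def)
    then obtain D' E' where DE: "D = s D'" "D' \<in> triang" "E = s E'" "E' \<in> I" using h(2) by auto
    show ?thesis
      unfolding DE(1,3) automorphism_bracket[OF DE(2) sub[OF DE(4)], symmetric]
      by (rule imageI[OF tri_ideal_bracket[OF I DE(2,4)]])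
  qed
qed

text \<open>
  Otherwise the images of \<open>I\<close> under the powers of \<open>s\<close> form a strictly descending chain. All of
  them contain the same tail, as \<open>s\<close> fixes the tails.
\<close>

lemma automorphism_not_shrinking:
  assumes I: "tri_ideal I"
  shows "\<not> s ` I \<subset> I"
proof
  assume shrink: "s ` I \<subset> I"
  have "I \<noteq> {\<lambda>f. 0}" using shrink by auto
  then obtain m where m: "tail (Suc m) \<subseteq> I" using nonzero_ideal_contains_tail[OF I] by blast
  let ?J = "\<lambda>n. ((`) s ^^ n) I"
  have ideal: "tri_ideal (?J n)" for n by (induction n) (simp_all add: I automorphism_image_ideal)
  have strict: "?J (Suc n) \<subset> ?J n" for n
  proof (induction n)
    case (Suc n)
    have "inj_on s (?J n)"
      using inj_on_subset[OF bij_betw_imp_inj_on[OF automorphism_bij]] tri_ideal_subset[OF ideal] by blast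
    then have "s ` ?J (Suc n) \<subset> s ` ?J n" using Suc by (rule image_strict_mono)
    then show ?case by simp
  qed (use shrink in simp)
  have "tail (Suc m) \<subseteq> ?J n" for n
  proof (induction n)
    case (Suc n)
    then show ?case using image_mono[OF Suc, of s] by (simp add: automorphism_tail)
  qed (use m in simp)
  then obtain N where N: "\<forall>n\<ge>N. ?J n = ?J N"
    using descending_chain_stabilizes[of ?J m, OF ideal psubset_imp_subset[OF strict]] by blast
  have "?J (Suc N) = ?J N" by (rule N[rule_format]) simp
  then show False using strict[of N] by simp
qed

end

lemma lie_automorphism_inv:
  assumes s: "lie_automorphism ring_of_type_algebra u_infinity s"
  shows "lie_automorphism ring_of_type_algebra u_infinity (inv_into triang s)"
proof -
  note bij = automorphism_bij[OF s]
  let ?t = "inv_into triang s"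
  have st: "s (?t D) = D" and t: "?t D \<in> triang" if "D \<in> triang" for D
    using bij that by (auto simp: bij_betw_inv_into_right bij_betw_def intro: inv_into_into)
  have uniq: "?t D = E" if "s E = D" "E \<in> triang" for D E
    using bij that by (auto simp: bij_betw_inv_into_left)
  show ?thesis unfolding tri_automorphism_iff
  proof (intro conjI ballI allI)
    show "bij_betw ?t triang triang" by (rule bij_betw_inv_into[OF bij])
  next
    fix D E :: "'a mpol \<Rightarrow> 'a mpol" assume D: "D \<in> triang" and E: "E \<in> triang"
    show "?t (\<lambda>f. D f + E f) = (\<lambda>f. ?t D f + ?t E f)"
      by (rule uniq) (simp_all add: automorphism_add[OF s] add_triang st t D E)
    show "?t (bracket D E) = bracket (?t D) (?t E)"
      by (rule uniq) (simp_all add: automorphism_bracket[OF s] bracket_triang st t D E)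
    show "?t (\<lambda>f. const_pol c * D f) = (\<lambda>f. const_pol c * ?t D f)" for c
      by (rule uniq) (simp_all add: automorphism_const_mult[OF s] const_mult_triang st t D)
  qed
qed

lemma automorphism_fixes_ideal:
  assumes s: "lie_automorphism ring_of_type_algebra u_infinity s" and I: "tri_ideal I"
  shows "s ` I = I"
proof -
  let ?t = "inv_into triang s"
  have inj: "inj_on s triang" using automorphism_bij[OF s] by (rule bij_betw_imp_inj_on)
  have ts: "?t ` s ` A = A" if "A \<subseteq> triang" for A
    by (rule inv_into_image_cancel[OF inj that])
  have "\<not> I \<subset> s ` I"
  proof
    assume grow: "I \<subset> s ` I"
    have "s ` I \<subseteq> triang" by (rule tri_ideal_subset[OF automorphism_image_ideal[OF s I]])
    then have "inj_on ?t (s ` I)"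
      using bij_betw_imp_inj_on[OF bij_betw_inv_into[OF automorphism_bij[OF s]]] inj_on_subset by blast
    then have "?t ` I \<subset> ?t ` s ` I" using grow by (rule image_strict_mono)
    then show False
      using automorphism_not_shrinking[OF lie_automorphism_inv[OF s] I] ts[OF tri_ideal_subset[OF I]] by simp
  qed
  moreover have "\<not> s ` I \<subset> I" by (rule automorphism_not_shrinking[OF s I])
  ultimately show ?thesis using tri_ideals_comparable[OF I automorphism_image_ideal[OF s I]] by blast
qed

section \<open>The uniserial dimension\<close>

text \<open>
  The least nonzero member of \<open>S\<close> contains a tail, and with it so do all other nonzero members.
  Hence one function \<open>ideal_rank m\<close> compares all of them.
\<close>

lemma well_ordered_ideals_le:
  fixes S :: "('k::field_char_0 mpol \<Rightarrow> 'k mpol) set set"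
  assumes S: "well_ordered_ideals ring_of_type_algebra u_infinity S"
  shows "(incl_order S, ord_exp omega omega) \<in> ordLeq"
proof -
  let ?Z = "{\<lambda>f. 0} :: ('k mpol \<Rightarrow> 'k mpol) set"
  have ideal: "tri_ideal I" if "I \<in> S" for I using S that by (simp add: well_ordered_ideals_def)
  obtain m where m: "\<And>I. I \<in> S - {?Z} \<Longrightarrow> tail (Suc m) \<subseteq> I"
  proof (cases "S - {?Z} = {}")
    case False
    have "\<exists>I\<in>S - {?Z}. \<forall>J\<in>S - {?Z}. I \<subseteq> J"
      using S False unfolding well_ordered_ideals_def by (meson Diff_subset)
    then obtain I where I: "I \<in> S - {?Z}" "\<forall>J\<in>S - {?Z}. I \<subseteq> J" ..
    then obtain m where "tail (Suc m) \<subseteq> I" using nonzero_ideal_contains_tail ideal by blast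
    then show thesis using that I(2) by (meson subset_trans)
  qed (use that in blast)
  \<comment> \<open>no nonzero ideal gets the zero function as its rank\<close>
  define r where "r I = (if I = ?Z then (\<lambda>_. 0) else ideal_rank m I)" for I
  have fin: "r I \<in> finsupp" for I by (simp add: r_def zero_finsupp ideal_rank_finsupp)
  show ?thesis
  proof (rule ordLeq_if_strict_mono[OF Well_order_incl_order[OF S] Well_order_ord_exp_omega_omega])
    show "r I \<in> Field (ord_exp omega omega)" for I by (simp add: Field_ord_exp_omega_omega fin)
    show "(r I, r J) \<in> ord_exp omega omega \<and> r I \<noteq> r J" if "(I, J) \<in> incl_order S" "I \<noteq> J" for I J
    proof -
      have IJ: "I \<in> S" "J \<in> S" "I \<subset> J" using that by (auto simp: incl_order_def)
      have JZ: "J \<noteq> ?Z" using IJ(3) tri_ideal_zero[OF ideal[OF IJ(1)]] by auto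
      have "colex (r I) (r J)"
      proof (cases "I = ?Z")
        case True
        have "(\<lambda>_. 0) = ideal_rank m J \<or> colex (\<lambda>_. 0) (ideal_rank m J)"
          by (rule colex_if_le[OF zero_finsupp ideal_rank_finsupp]) simp
        then have "colex (\<lambda>_. 0) (ideal_rank m J)" using ideal_rank_nonzero[of m J] by metis
        then show ?thesis using True JZ by (simp add: r_def)
      next
        case False
        then show ?thesis using JZ IJ m[of I] ideal by (simp add: r_def ideal_rank_strict_mono)
      qed
      then show ?thesis using fin colex_irrefl by (auto simp: ord_exp_omega_omega)
    qed
  qed
qed

text \<open>
  The lower bound needs arbitrarily long chains: taking all vectors supported on \<open>{..<m}\<close>, the ideals
  inside block \<open>m\<close> realise the order type \<open>\<omega>\<^sup>m\<close>.
\<close>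

lemma well_ordered_lower_ideals:
  assumes "\<And>a. a \<in> A \<Longrightarrow> supported m a"
  shows "well_ordered_ideals ring_of_type_algebra (u_infinity :: ('k::field_char_0, _) module) (lower m ` A)"
proof -
  have mono: "lower m a \<subseteq> (lower m b :: ('k mpol \<Rightarrow> 'k mpol) set)" if "a \<preceq> b" "a \<in> A" for a b
    using that lower_strict_mono[OF _ assms[OF that(2)], of b] by blast
  show ?thesis unfolding well_ordered_ideals_def
  proof (intro conjI ballI allI impI)
    show "tri_ideal I" if "I \<in> lower m ` A" for I :: "('k mpol \<Rightarrow> 'k mpol) set"
      using that tri_ideal_lower by blast
    show "I \<subseteq> J \<or> J \<subseteq> I" if "I \<in> lower m ` A" "J \<in> lower m ` A" for I J :: "('k mpol \<Rightarrow> 'k mpol) set"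
      using that mono mon_total by (metis imageE)
    fix T :: "('k mpol \<Rightarrow> 'k mpol) set set" assume T: "T \<subseteq> lower m ` A" "T \<noteq> {}"
    let ?B = "{a\<in>A. lower m a \<in> T}"
    have "lk ` ?B \<subseteq> finsupp" "lk ` ?B \<noteq> {}" using T by auto
    then obtain f where f: "f \<in> lk ` ?B" "\<forall>g\<in>lk ` ?B. f = g \<or> colex f g"
      using colex_least by meson
    then obtain a where a: "a \<in> ?B" "f = lk a" by blast
    have "lower m a \<subseteq> I" if I: "I \<in> T" for I
    proof -
      obtain b where b: "b \<in> ?B" "I = lower m b" using I T(1) by blast
      have "lk a = lk b \<or> a \<prec> b" using f(2) b(1) unfolding a(2) by blast
      then have "a \<preceq> b" using poly_mapping_eqI by metis
      then show ?thesis using mono a(1) b(2) by blast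
    qed
    then show "\<exists>I\<in>T. \<forall>J\<in>T. I \<subseteq> J" using a(1) by blast
  qed
qed

text \<open>
  If a bound \<open>r\<close> were shorter than \<open>\<omega>\<^sup>\<omega>\<close>, it would embed below some \<open>b\<close>. The vectors up to \<open>b\<close> are
  supported on a common \<open>{..<m}\<close>, so they index a chain of ideals; mapping this chain into \<open>r\<close> and
  back below \<open>b\<close> gives a strictly monotone map of a set of vectors into itself that lowers \<open>b\<close>.
\<close>

lemma u_infinity_uniserial_dim:
  "has_uniserial_dim ring_of_type_algebra (u_infinity :: ('k::field_char_0, _) module) (ord_exp omega omega)"
  unfolding has_uniserial_dim_def
proof (intro conjI allI impI)
  let ?W = "ord_exp omega omega"
  show "Well_order ?W" by (rule Well_order_ord_exp_omega_omega)
  show "(incl_order S, ?W) \<in> ordLeq" if "well_ordered_ideals ring_of_type_algebra u_infinity S"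
    for S :: "('k mpol \<Rightarrow> 'k mpol) set set"
    by (rule well_ordered_ideals_le[OF that])
  fix r :: "(nat \<Rightarrow> nat) rel"
  assume r: "Well_order r" and bound: "\<forall>S :: ('k mpol \<Rightarrow> 'k mpol) set set.
    well_ordered_ideals ring_of_type_algebra u_infinity S \<longrightarrow> (incl_order S, r) \<in> ordLeq"
  show "(?W, r) \<in> ordLeq"
  proof (rule ccontr)
    assume "(?W, r) \<notin> ordLeq"
    then have "(r, ?W) \<in> ordLess" using r Well_order_ord_exp_omega_omega not_ordLeq_iff_ordLess by blast
    then obtain e b where b: "b \<in> Field ?W"
      and e: "\<forall>x\<in>Field r. e x \<in> Field ?W \<and> (e x, b) \<in> ?W \<and> e x \<noteq> b"
      and em: "\<forall>x y. (x, y) \<in> r \<longrightarrow> x \<noteq> y \<longrightarrow> (e x, e y) \<in> ?W \<and> e x \<noteq> e y"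
      by (elim ordLess_bounded_embedding[elim_format] exE conjE)
    have bf: "b \<in> finsupp" using b by (simp add: Field_ord_exp_omega_omega)
    obtain m where m: "\<forall>x\<ge>m. b x = 0" using finsupp_bound[OF bf] ..
    define D where "D = {f \<in> finsupp. f = b \<or> colex f b}"
    let ?M = "Poly_Mapping.Abs_poly_mapping :: (nat \<Rightarrow> nat) \<Rightarrow> (nat \<Rightarrow>\<^sub>0 nat)"
    let ?I = "\<lambda>f. lower m (?M f) :: ('k mpol \<Rightarrow> 'k mpol) set"
    have M: "lk (?M f) = f" if "f \<in> D" for f
      by (rule lookup_Abs_poly_mapping) (use that in \<open>simp add: D_def finsupp_def\<close>)
    have supp: "supported m (?M f)" if f: "f \<in> D" for f
      unfolding supported_iff M[OF f]
    proof (rule ccontr)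
      assume "\<not> (\<forall>i\<ge>m. f i = 0)"
      then have "f \<noteq> b" using m by blast
      then obtain k where k: "f k < b k" "\<forall>l>k. f l = b l" using f by (auto simp: D_def colex_def)
      then have "k < m" using m by (metis less_nat_zero_code not_le)
      then show False using k(2) m \<open>\<not> (\<forall>i\<ge>m. f i = 0)\<close> by (metis less_le_trans)
    qed
    have wo: "well_ordered_ideals ring_of_type_algebra u_infinity (?I ` D)"
      using well_ordered_lower_ideals[of "?M ` D" m] supp by (auto simp: image_image)
    then have "(incl_order (?I ` D), r) \<in> ordLeq" using bound by blast
    then obtain \<phi> where \<phi>: "\<forall>x\<in>Field (incl_order (?I ` D)). \<phi> x \<in> Field r"
      and \<phi>m: "\<forall>x y. (x, y) \<in> incl_order (?I ` D) \<longrightarrow> x \<noteq> y \<longrightarrow> (\<phi> x, \<phi> y) \<in> r \<and> \<phi> x \<noteq> \<phi> y"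
      by (elim ordLeq_strict_mono_embedding[elim_format] exE conjE)
    let ?h = "\<lambda>f. e (\<phi> (?I f))"
    have h: "?h f \<in> D \<and> colex (?h f) b" if "f \<in> D" for f
      using e[rule_format, OF \<phi>[rule_format, of "?I f"]] that by (auto simp: Field_incl_order D_def ord_exp_omega_omega)
    have "(b, ?h b) \<in> ?W"
    proof (rule strict_mono_inflationary[OF Well_order_ord_exp_omega_omega, of D])
      show "D \<subseteq> Field ?W" by (auto simp: D_def Field_ord_exp_omega_omega)
      show "b \<in> D" using bf by (simp add: D_def)
      show "?h f \<in> D" if "f \<in> D" for f using h[OF that] by blast
      fix f g assume fg: "f \<in> D" "g \<in> D" "(f, g) \<in> ?W" "f \<noteq> g"
      then have "?M f \<prec> ?M g" by (simp add: M ord_exp_omega_omega)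
      then have "?I f \<subset> ?I g" by (rule lower_strict_mono[OF _ supp[OF fg(1)]])
      then have "(?I f, ?I g) \<in> incl_order (?I ` D)" "?I f \<noteq> ?I g"
        using fg by (auto simp: incl_order_def)
      then show "(?h f, ?h g) \<in> ?W \<and> ?h f \<noteq> ?h g" by (intro em[rule_format]; simp add: \<phi>m)
    qed
    moreover have "colex (?h b) b" using h[of b] bf by (simp add: D_def)
    ultimately show False using colex_asym colex_irrefl by (auto simp: ord_exp_omega_omega)
  qed
qed

theorem corollary6p4:
  fixes K :: "'k::field_char_0 ring"
    and G :: "('k, 'k mpol \<Rightarrow> 'k mpol) module"
  assumes K: "K = ring_of_type_algebra"
    and G: "G = u_infinity"
  shows "(lie_algebra K G \<and> uniserial K G \<and> \<not> lie_artinian K G \<and> \<not> lie_noetherian K G \<and>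
          almost_artinian K G \<and> has_uniserial_dim K G (ord_exp omega omega)) \<and>
         (\<forall>I. lie_ideal K G I \<longrightarrow> characteristic_ideal K G I)"
  unfolding K G
proof (intro conjI allI impI)
  show "lie_algebra ring_of_type_algebra (u_infinity :: ('k, 'k mpol \<Rightarrow> 'k mpol) module)"
    by (rule lie_algebra_u_infinity)
  show "uniserial ring_of_type_algebra (u_infinity :: ('k, 'k mpol \<Rightarrow> 'k mpol) module)"
    unfolding uniserial_def by (intro allI impI tri_ideals_comparable)
  show "characteristic_ideal ring_of_type_algebra u_infinity I" if "tri_ideal I"
    for I :: "('k mpol \<Rightarrow> 'k mpol) set"
    unfolding characteristic_ideal_def using that by (intro conjI allI impI automorphism_fixes_ideal)
qed (rule u_infinity_not_artinian u_infinity_not_noetherian u_infinity_almost_artinian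
    u_infinity_uniserial_dim)+

end
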